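(* The pointwise representable $1$-cells in the bicategory $\mathsf{UEsp}$ are closed under composition. The induced composition on representing data is as follows. (1) On ultramatrices: if $F\in\mathsf{UEsp}(X,Y)$ and $G\in\mathsf{UEsp}(Y,Z)$ are represented by ultramatrices $(M,\mathcal U)$ from $X$ to $Y$ and $(N,\mathcal V)$ from $Y$ to $Z$, then the composite $GF\in\mathsf{UEsp}(X,Z)$ is represented by the composite ultramatrix $(N\cdot M,\mathcal V\cdot\mathcal U)$. (2) On ultraspans: if $F$ and $G$ are represented by ultraspans $(f,(g,\mathcal U))\colon X\to Y$ and $(h,(k,\mathcal V))\colon Y\to Z$, then $GF$ is represented by their composite ultraspan $(fp,(kq,\mathcal V\mathcal W))\colon X\to Z$. (Composition of ultramatrices and of ultraspans is as defined in the context.)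
   Context: **Ultrafilters.** For an indexed family of sets $(Y(x)\mid x\in X)$, the set $\Sigma_{x\in X}Y(x)$ is $\{(x,y):x\in X,y\in Y(x)\}$. If $\mathcal U$ is an ultrafilter on $X$ and $\mathcal V(x)$ an ultrafilter on $Y(x)$ for each $x\in X$, the indexed sum $(\Sigma_{\mathcal U}x\in X)\mathcal V(x)$ is the ultrafilter on $\Sigma_{x\in X}Y(x)$ containing $A$ iff $\{x\in X:\{y\in Y(x):(x,y)\in A\}\in\mathcal V(x)\}\in\mathcal U$. **The category $\mathcal{UF}_{\mathcal C}$.** For $\mathcal C$ extensive (finite coproducts exist and each $+\colon\mathcal C/A\times\mathcal C/B\to\mathcal C/(A+B)$ is an equivalence), $\mathrm{Sum}_{\mathcal C}(C)$ is the Boolean algebra of isomorphism classes of coproduct coprojections into $C$, with pullback homomorphisms $f^{-1}$; $\beta C$ is the set of ultrafilters of $\mathrm{Sum}_{\mathcal C}(C)$, and $f_!(\mathcal U)=\{V:f^{-1}(V)\in\mathcal U\}$. Objects of $\mathcal{UF}_{\mathcal C}$ are pairs $(C,\mathcal U)$ with $\mathcal U\in\beta C$; morphisms $(C,\mathcal U)\to(D,\mathcal V)$ are equivalence classes $[f]$ of maps $f\colon U\to D$ with domain some $U\rightarrowtail C$ in $\mathcal U$, such that $V\in\mathcal V$ iff $f^{-1}(V)\rightarrowtail U\rightarrowtail C$ is in $\mathcal U$ for all $V\in\mathrm{Sum}_{\mathcal C}(D)$; two such are identified if they agree on some $W\in\mathcal U$ contained in both domains. For $\mathcal C=\mathbf{Set}^X$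 and $A\in\mathbf{Set}^X$, one has $\mathrm{Sum}(A)\cong\mathcal P(\Sigma_{x\in X}A(x))$, so ultrafilters on $A$ are identified with ultrafilters on the set $\Sigma_{x\in X}A(x)$. **The bicategory $\mathsf{UEsp}$.** $\mathsf{FC}_{\mathbf{Set}}$ is the 2-category with sets as objects, hom-categories $\mathsf{FC}(\mathbf{Set}^X,\mathbf{Set}^Y)$ (finite-coproduct-preserving functors and natural transformations), and the usual composition. There are equivalences $\int\colon[\mathcal{UF}_{\mathbf{Set}^X},\mathbf{Set}^Y]\simeq\mathsf{FC}(\mathbf{Set}^X,\mathbf{Set}^Y)$ with $(\int F)(H)(y)=\sum_{\mathcal U\in\beta H}F(H,\mathcal U)(y)$, and $(\int F)(f)$ mapping the $\mathcal U$-summand to the $f_!(\mathcal U)$-summand via $F([f])$. $\mathsf{UEsp}$ is the bicategory with sets as objects, hom-categories $\mathsf{UEsp}(X,Y)=[\mathcal{UF}_{\mathbf{Set}^X},\mathbf{Set}^Y]$, and composition obtained from that of $\mathsf{FC}_{\mathbf{Set}}$ by transport across these equivalences (so $\int(GF)\cong\int G\circ\int F$). A 1-cell $F\in\mathsf{UEsp}(X,Y)$ is pointwise representable if for each $y\in Y$ the functor $F(-)(y)\colon\mathcal{UF}_{\mathbf{Set}^X}\to\mathbf{Set}$ is representable. **Ultramatrices.** An ultramatrix from $X$ to $Y$ is a pair $(M,\mathcal U)$ of a matrix of sets $M\in\mathbf{Set}^{X\times Y}$ and a $Y$-indexed family of ultrafilters $\mathcal U_y$ on each column sum $M_y=\Sigma_{x\in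 X}M(x,y)$. It represents $F\in\mathsf{UEsp}(X,Y)$ when, for each $y$, $F(-)(y)$ is represented by the object $(M(-,y)\in\mathbf{Set}^X,\ \mathcal U_y)$. The composition of ultramatrices $(M,\mathcal U)$ from $X$ to $Y$ and $(N,\mathcal V)$ from $Y$ to $Z$ is $(N\cdot M,\mathcal V\cdot\mathcal U)$, where $(N\cdot M)(x,z)=\Sigma_{y\in Y}(N(y,z)\times M(x,y))$ and $(\mathcal V\cdot\mathcal U)_z$ is the transport of $(\Sigma_{\mathcal V_z}(y,n)\in N_z)\,\mathcal U_y$ across the isomorphism $\Sigma_{(y,n)\in N_z}M_y\cong(N\cdot M)_z$ sending $(y,n,x,m)$ to $(x,y,n,m)$. **Ultraspans.** An ultrafamily $(g,\mathcal U)\colon M\rightsquigarrow Y$ is a function $g\colon M\to Y$ with an ultrafilter $\mathcal U_y$ on each fibre $g^{-1}(y)$. An ultraspan $(f,(g,\mathcal U))$ from $X$ to $Y$ is a set $M$, a function $f\colon M\to X$, and an ultrafamily $(g,\mathcal U)\colon M\rightsquigarrow Y$. It corresponds to the ultramatrix with entries $f^{-1}(x)\cap g^{-1}(y)$ and with ultrafilter on the $y$-th column sum ($\cong g^{-1}(y)$) given by $\mathcal U_y$, and it represents the same 1-cell of $\mathsf{UEsp}$ as this ultramatrix. Given ultraspans $(f,(g,\mathcal U))\colon X\to Y$ with apex $M$ and $(h,(k,\mathcal V))\colon Y\to Z$ with apex $N$, let $p\colon M\times_YN\to M$ and $q\colon M\times_YN\to N$ be the pullback of $g$ and $h$. Let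 $\mathcal W_n$ be the transport of $\mathcal U_{h(n)}$ across $g^{-1}(h(n))\cong q^{-1}(n)$, and let $(\mathcal V\mathcal W)_z$ be the transport of $(\Sigma_{\mathcal V_z}n\in k^{-1}(z))\,\mathcal W_n$ across $\Sigma_{n\in k^{-1}(z)}q^{-1}(n)\cong(kq)^{-1}(z)$. The composite ultraspan is $(fp,(kq,\mathcal V\mathcal W))$. *)

theory Defs
  imports Main "HOL-Library.FuncSet"
begin

unbundle cardinal_syntax

section \<open>The universe of sets\<close>

text \<open>
  No HOL type is closed under all the constructions on sets used below, so the category of sets is
  taken relative to a universe: a type \<open>'u\<close> whose cardinality is infinite, regular and a strong limit.
  A set over \<^emph>\<open>any\<close> type counts as a set of the universe (is small) when its cardinality is less than
  that of \<open>'u\<close>; then it is in bijection with a subset of \<open>'u\<close>. Uncountability is not demanded, so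
  finite sets (\<open>'u = nat\<close>) are one admissible instance.
\<close>

definition small :: "'u itself \<Rightarrow> 'a set \<Rightarrow> bool" where
  "small _ A \<longleftrightarrow> |A| <o |UNIV :: 'u set|"

definition set_universe :: "'u itself \<Rightarrow> bool" where
  "set_universe u \<longleftrightarrow>
     infinite (UNIV :: 'u set) \<and> regularCard |UNIV :: 'u set| \<and>
     (\<forall>A :: 'u set. small u A \<longrightarrow> small u (Pow A))"


section \<open>Categories and functors\<close>

text \<open>\<open>Comp C a b c g f\<close> is the composite of \<open>f : a \<rightarrow> b\<close> and \<open>g : b \<rightarrow> c\<close>.\<close>

record ('o, 'a) category =
  Obj :: "'o set"
  Hom :: "'o \<Rightarrow> 'o \<Rightarrow> 'a set"
  Id :: "'o \<Rightarrow> 'a"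
  Comp :: "'o \<Rightarrow> 'o \<Rightarrow> 'o \<Rightarrow> 'a \<Rightarrow> 'a \<Rightarrow> 'a"

record ('o, 'a, 'p, 'b) ftr =
  fobj :: "'o \<Rightarrow> 'p"
  farr :: "'o \<Rightarrow> 'o \<Rightarrow> 'a \<Rightarrow> 'b"

definition is_functor :: "('o, 'a) category \<Rightarrow> ('p, 'b) category \<Rightarrow> ('o, 'a, 'p, 'b) ftr \<Rightarrow> bool" where
  "is_functor C D F \<longleftrightarrow>
     (\<forall>a\<in>Obj C. fobj F a \<in> Obj D) \<and>
     (\<forall>a\<in>Obj C. \<forall>b\<in>Obj C. \<forall>f\<in>Hom C a b. farr F a b f \<in> Hom D (fobj F a) (fobj F b)) \<and>
     (\<forall>a\<in>Obj C. farr F a a (Id C a) = Id D (fobj F a)) \<and>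
     (\<forall>a\<in>Obj C. \<forall>b\<in>Obj C. \<forall>c\<in>Obj C. \<forall>f\<in>Hom C a b. \<forall>g\<in>Hom C b c.
        farr F a c (Comp C a b c g f) =
        Comp D (fobj F a) (fobj F b) (fobj F c) (farr F b c g) (farr F a b f))"

definition ftr_comp :: "('p, 'b, 'q, 'c) ftr \<Rightarrow> ('o, 'a, 'p, 'b) ftr \<Rightarrow> ('o, 'a, 'q, 'c) ftr" where
  "ftr_comp G F =
     \<lparr>fobj = (\<lambda>a. fobj G (fobj F a)),
      farr = (\<lambda>a b f. farr G (fobj F a) (fobj F b) (farr F a b f))\<rparr>"

text \<open>
  \<open>fam_cat X\<close> is \<open>Set\<^sup>X\<close>. Families are empty, and hence maps of families undefined, off \<open>X\<close>, so that
  families and maps that agree on \<open>X\<close> are equal.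
\<close>

definition fam_cat :: "'x set \<Rightarrow> ('x \<Rightarrow> 'u set, 'x \<Rightarrow> 'u \<Rightarrow> 'u) category" where
  "fam_cat X =
     \<lparr>Obj = {H. (\<forall>x\<in>X. small TYPE('u) (H x)) \<and> (\<forall>x. x \<notin> X \<longrightarrow> H x = {})},
      Hom = (\<lambda>H K. {f. \<forall>x. f x \<in> H x \<rightarrow>\<^sub>E K x}),
      Id = (\<lambda>H x. restrict id (H x)),
      Comp = (\<lambda>H K L g f x. compose (H x) (g x) (f x))\<rparr>"

text \<open>
  Isomorphism of Set-valued functors. The two functors may take values in sets over different types.
\<close>

definition set_iso ::
  "('o, 'a) category \<Rightarrow> ('o, 'a, 'v set, 'v \<Rightarrow> 'v) ftr \<Rightarrow> ('o, 'a, 'w set, 'w \<Rightarrow> 'w) ftr \<Rightarrow> bool" where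
  "set_iso C P Q \<longleftrightarrow>
     (\<exists>\<alpha>. (\<forall>a\<in>Obj C. bij_betw (\<alpha> a) (fobj P a) (fobj Q a)) \<and>
          (\<forall>a\<in>Obj C. \<forall>b\<in>Obj C. \<forall>f\<in>Hom C a b. \<forall>t\<in>fobj P a.
             \<alpha> b (farr P a b f t) = farr Q a b f (\<alpha> a t)))"

definition at_index ::
  "('o, 'a, 'y \<Rightarrow> 'v set, 'y \<Rightarrow> 'v \<Rightarrow> 'v) ftr \<Rightarrow> 'y \<Rightarrow> ('o, 'a, 'v set, 'v \<Rightarrow> 'v) ftr" where
  "at_index F y = \<lparr>fobj = (\<lambda>a. fobj F a y), farr = (\<lambda>a b f. farr F a b f y)\<rparr>"

text \<open>Isomorphism of functors valued in \<open>Set\<^sup>Y\<close>.\<close>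

definition fam_iso ::
  "('o, 'a) category \<Rightarrow> 'y set \<Rightarrow> ('o, 'a, 'y \<Rightarrow> 'v set, 'y \<Rightarrow> 'v \<Rightarrow> 'v) ftr \<Rightarrow>
   ('o, 'a, 'y \<Rightarrow> 'w set, 'y \<Rightarrow> 'w \<Rightarrow> 'w) ftr \<Rightarrow> bool" where
  "fam_iso C Y P Q \<longleftrightarrow> (\<forall>y\<in>Y. set_iso C (at_index P y) (at_index Q y))"


section \<open>Ultrafilters\<close>

text \<open>
  Filters on a set \<open>A\<close> are filters on the ambient type that lie below \<open>principal A\<close>;
  \<open>W\<close> belongs to the filter \<open>\<U>\<close> when \<open>large \<U> W\<close>. Transport along a bijection is \<open>filtermap\<close>.
\<close>

abbreviation large :: "'a filter \<Rightarrow> 'a set \<Rightarrow> bool" where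
  "large \<U> W \<equiv> \<forall>\<^sub>F p in \<U>. p \<in> W"

definition ultrafilter_on :: "'a set \<Rightarrow> 'a filter \<Rightarrow> bool" where
  "ultrafilter_on A \<U> \<longleftrightarrow>
     \<U> \<le> principal A \<and> \<U> \<noteq> bot \<and> (\<forall>W\<subseteq>A. large \<U> W \<or> large \<U> (A - W))"

definition ultra_sum :: "'a filter \<Rightarrow> ('a \<Rightarrow> 'b filter) \<Rightarrow> ('a \<times> 'b) filter" where
  "ultra_sum \<U> \<V> = Abs_filter (\<lambda>P. \<forall>\<^sub>F x in \<U>. \<forall>\<^sub>F y in \<V> x. P (x, y))"

lemma eventually_ultra_sum:
  "eventually P (ultra_sum \<U> \<V>) \<longleftrightarrow> (\<forall>\<^sub>F x in \<U>. \<forall>\<^sub>F y in \<V> x. P (x, y))"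
proof -
  have "is_filter (\<lambda>P. \<forall>\<^sub>F x in \<U>. \<forall>\<^sub>F y in \<V> x. P (x, y))"
    by (rule is_filter.intro) (auto elim!: eventually_mono eventually_elim2 simp: eventually_conj_iff)
  then show ?thesis
    unfolding ultra_sum_def by (rule eventually_Abs_filter)
qed

text \<open>
  For \<open>A \<in> Set\<^sup>X\<close> the Boolean algebra of coproduct coprojections into \<open>A\<close> is the powerset of
  \<open>\<Sigma>\<^bsub>x\<in>X\<^esub> A x\<close>, so \<open>ultras X A\<close> is \<open>\<beta>A\<close>.
\<close>

definition ultras :: "'x set \<Rightarrow> ('x \<Rightarrow> 'a set) \<Rightarrow> ('x \<times> 'a) filter set" where
  "ultras X A = {\<U>. ultrafilter_on (Sigma X A) \<U>}"

text \<open>The push-forward \<open>f\<^sub>!\<close>.\<close>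

definition push :: "('x \<Rightarrow> 'a \<Rightarrow> 'b) \<Rightarrow> ('x \<times> 'a) filter \<Rightarrow> ('x \<times> 'b) filter" where
  "push f \<U> = filtermap (\<lambda>(x, a). (x, f x a)) \<U>"


section \<open>The category of ultrafilters over \<open>Set\<^sup>X\<close>\<close>

type_synonym ('x, 'a) ufobj = "('x \<Rightarrow> 'a set) \<times> ('x \<times> 'a) filter"

text \<open>
  A map \<open>U \<rightarrow> B\<close> with \<open>U\<close> a subfamily of \<open>A\<close> is a partial function \<open>f\<close> with \<open>dom f = U\<close> (seen as a
  subset of \<open>\<Sigma>\<^bsub>x\<in>X\<^esub> A x\<close>). The element types of source and target may differ, so that small families
  over arbitrary types can be used as sources.
\<close>

type_synonym ('x, 'a, 'b) pmap = "'x \<times> 'a \<rightharpoonup> 'b"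

definition pmap_preimage :: "('x, 'a, 'b) pmap \<Rightarrow> ('x \<times> 'b) set \<Rightarrow> ('x \<times> 'a) set" where
  "pmap_preimage f V = {(x, a). \<exists>b. f (x, a) = Some b \<and> (x, b) \<in> V}"

definition uf_maps :: "'x set \<Rightarrow> ('x, 'a) ufobj \<Rightarrow> ('x, 'b) ufobj \<Rightarrow> ('x, 'a, 'b) pmap set" where
  "uf_maps X = (\<lambda>(A, \<U>) (B, \<V>).
     {f. dom f \<subseteq> Sigma X A \<and> large \<U> (dom f) \<and>
         (\<forall>x a b. f (x, a) = Some b \<longrightarrow> b \<in> B x) \<and>
         (\<forall>V\<subseteq>Sigma X B. large \<V> V \<longleftrightarrow> large \<U> (pmap_preimage f V))})"

definition uf_eq ::
  "'x set \<Rightarrow> ('x, 'a) ufobj \<Rightarrow> ('x, 'b) ufobj \<Rightarrow> (('x, 'a, 'b) pmap \<times> ('x, 'a, 'b) pmap) set" where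
  "uf_eq X c d =
     {(f, g). f \<in> uf_maps X c d \<and> g \<in> uf_maps X c d \<and>
              (\<exists>W. large (snd c) W \<and> W \<subseteq> dom f \<inter> dom g \<and> (\<forall>p\<in>W. f p = g p))}"

definition uf_class ::
  "'x set \<Rightarrow> ('x, 'a) ufobj \<Rightarrow> ('x, 'b) ufobj \<Rightarrow> ('x, 'a, 'b) pmap \<Rightarrow> ('x, 'a, 'b) pmap set" where
  "uf_class X c d f = uf_eq X c d `` {f}"

definition uf_hom ::
  "'x set \<Rightarrow> ('x, 'a) ufobj \<Rightarrow> ('x, 'b) ufobj \<Rightarrow> ('x, 'a, 'b) pmap set set" where
  "uf_hom X c d = uf_maps X c d // uf_eq X c d"

definition pmap_comp :: "('x, 'b, 'c) pmap \<Rightarrow> ('x, 'a, 'b) pmap \<Rightarrow> ('x, 'a, 'c) pmap" where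
  "pmap_comp g f = (\<lambda>(x, a). Option.bind (f (x, a)) (\<lambda>b. g (x, b)))"

text \<open>The class of \<open>pmap_comp g f\<close>, for any representatives of \<open>k = [g]\<close> and \<open>h = [f]\<close>.\<close>

definition uf_comp ::
  "'x set \<Rightarrow> ('x, 'a) ufobj \<Rightarrow> ('x, 'c) ufobj \<Rightarrow>
   ('x, 'b, 'c) pmap set \<Rightarrow> ('x, 'a, 'b) pmap set \<Rightarrow> ('x, 'a, 'c) pmap set" where
  "uf_comp X c e k h = (\<Union>f\<in>h. \<Union>g\<in>k. uf_class X c e (pmap_comp g f))"

definition total_pmap :: "'x set \<Rightarrow> ('x \<Rightarrow> 'a set) \<Rightarrow> ('x \<Rightarrow> 'a \<Rightarrow> 'b) \<Rightarrow> ('x, 'a, 'b) pmap" where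
  "total_pmap X A f = (\<lambda>(x, a). if (x, a) \<in> Sigma X A then Some (f x a) else None)"

definition uf_cat :: "'x set \<Rightarrow> (('x, 'u) ufobj, ('x, 'u, 'u) pmap set) category" where
  "uf_cat X =
     \<lparr>Obj = {(A, \<U>). A \<in> Obj (fam_cat X) \<and> \<U> \<in> ultras X A},
      Hom = uf_hom X,
      Id = (\<lambda>c. uf_class X c c (total_pmap X (fst c) (\<lambda>x a. a))),
      Comp = (\<lambda>c d e. uf_comp X c e)\<rparr>"

definition uf_hom_ftr ::
  "'x set \<Rightarrow> ('x, 'a) ufobj \<Rightarrow>
   (('x, 'u) ufobj, ('x, 'u, 'u) pmap set, ('x, 'a, 'u) pmap set set,
    ('x, 'a, 'u) pmap set \<Rightarrow> ('x, 'a, 'u) pmap set) ftr" where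
  "uf_hom_ftr X c = \<lparr>fobj = uf_hom X c, farr = (\<lambda>d e k h. uf_comp X c e k h)\<rparr>"


section \<open>The bicategory of ultraspecies\<close>

type_synonym ('x, 'y, 'u) uesp =
  "(('x, 'u) ufobj, ('x, 'u, 'u) pmap set, 'y \<Rightarrow> 'u set, 'y \<Rightarrow> 'u \<Rightarrow> 'u) ftr"

definition one_cell :: "'x set \<Rightarrow> 'y set \<Rightarrow> ('x, 'y, 'u) uesp \<Rightarrow> bool" where
  "one_cell X Y F \<longleftrightarrow> is_functor (uf_cat X) (fam_cat Y) F"

definition integral ::
  "'x set \<Rightarrow> ('x, 'y, 'u) uesp \<Rightarrow>
   ('x \<Rightarrow> 'u set, 'x \<Rightarrow> 'u \<Rightarrow> 'u, 'y \<Rightarrow> (('x \<times> 'u) filter \<times> 'u) set,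
    'y \<Rightarrow> ('x \<times> 'u) filter \<times> 'u \<Rightarrow> ('x \<times> 'u) filter \<times> 'u) ftr" where
  "integral X F =
     \<lparr>fobj = (\<lambda>H y. SIGMA \<U>:ultras X H. fobj F (H, \<U>) y),
      farr = (\<lambda>H K f y. restrict
        (\<lambda>(\<U>, t). (push f \<U>,
           farr F (H, \<U>) (K, push f \<U>)
             (uf_class X (H, \<U>) (K, push f \<U>) (total_pmap X H f)) y t))
        (SIGMA \<U>:ultras X H. fobj F (H, \<U>) y))\<rparr>"

text \<open>
  Composition in \<open>UEsp\<close> is composition of functors transported along \<open>\<integral>\<close>, hence determined up to
  isomorphism: \<open>K\<close> is a composite \<open>G F\<close> when \<open>\<integral>K \<cong> \<integral>G \<circ> \<integral>F\<close>. The values of \<open>\<integral>F\<close> are small sets over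
  the type \<open>('x \<times> 'u) filter \<times> 'u\<close>, so in the composite \<open>\<integral>F\<close> is replaced by an isomorphic functor \<open>T\<close>
  whose values are families of subsets of \<open>'u\<close>.
\<close>

definition is_composite ::
  "'x set \<Rightarrow> 'y set \<Rightarrow> 'z set \<Rightarrow> ('y, 'z, 'u) uesp \<Rightarrow> ('x, 'y, 'u) uesp \<Rightarrow> ('x, 'z, 'u) uesp \<Rightarrow> bool" where
  "is_composite X Y Z G F K \<longleftrightarrow>
     one_cell X Z K \<and>
     (\<exists>T. is_functor (fam_cat X) (fam_cat Y) T \<and>
          fam_iso (fam_cat X) Y T (integral X F) \<and>
          fam_iso (fam_cat X) Z (integral X K) (ftr_comp (integral Y G) T))"

definition pointwise_representable :: "'x set \<Rightarrow> 'y set \<Rightarrow> ('x, 'y, 'u) uesp \<Rightarrow> bool" where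
  "pointwise_representable X Y F \<longleftrightarrow>
     one_cell X Y F \<and>
     (\<forall>y\<in>Y. \<exists>c :: ('x, 'u) ufobj. c \<in> Obj (uf_cat X) \<and>
        set_iso (uf_cat X) (at_index F y) (uf_hom_ftr X c))"


section \<open>Ultramatrices\<close>

definition ultramatrix ::
  "'u itself \<Rightarrow> 'x set \<Rightarrow> 'y set \<Rightarrow> ('x \<Rightarrow> 'y \<Rightarrow> 'm set) \<Rightarrow> ('y \<Rightarrow> ('x \<times> 'm) filter) \<Rightarrow> bool" where
  "ultramatrix u X Y M \<U> \<longleftrightarrow>
     (\<forall>x\<in>X. \<forall>y\<in>Y. small u (M x y)) \<and>
     (\<forall>y\<in>Y. ultrafilter_on (SIGMA x:X. M x y) (\<U> y))"

definition ultramatrix_represents ::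
  "'x set \<Rightarrow> 'y set \<Rightarrow> ('x \<Rightarrow> 'y \<Rightarrow> 'm set) \<Rightarrow> ('y \<Rightarrow> ('x \<times> 'm) filter) \<Rightarrow> ('x, 'y, 'u) uesp \<Rightarrow> bool" where
  "ultramatrix_represents X Y M \<U> F \<longleftrightarrow>
     ultramatrix TYPE('u) X Y M \<U> \<and> one_cell X Y F \<and>
     (\<forall>y\<in>Y. set_iso (uf_cat X) (at_index F y) (uf_hom_ftr X (\<lambda>x. M x y, \<U> y)))"

definition mat_comp ::
  "'y set \<Rightarrow> ('y \<Rightarrow> 'z \<Rightarrow> 'n set) \<Rightarrow> ('x \<Rightarrow> 'y \<Rightarrow> 'm set) \<Rightarrow> 'x \<Rightarrow> 'z \<Rightarrow> ('y \<times> 'n \<times> 'm) set" where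
  "mat_comp Y N M x z = (SIGMA y:Y. N y z \<times> M x y)"

definition mat_ultra_comp ::
  "('z \<Rightarrow> ('y \<times> 'n) filter) \<Rightarrow> ('y \<Rightarrow> ('x \<times> 'm) filter) \<Rightarrow> 'z \<Rightarrow> ('x \<times> 'y \<times> 'n \<times> 'm) filter" where
  "mat_ultra_comp \<V> \<U> z =
     filtermap (\<lambda>((y, n), (x, m)). (x, (y, n, m))) (ultra_sum (\<V> z) (\<lambda>(y, n). \<U> y))"


section \<open>Ultraspans\<close>

definition ultrafamily :: "'m set \<Rightarrow> 'y set \<Rightarrow> ('m \<Rightarrow> 'y) \<Rightarrow> ('y \<Rightarrow> 'm filter) \<Rightarrow> bool" where
  "ultrafamily M Y g \<U> \<longleftrightarrow>
     g \<in> M \<rightarrow> Y \<and> (\<forall>y\<in>Y. ultrafilter_on {m \<in> M. g m = y} (\<U> y))"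

definition ultraspan ::
  "'u itself \<Rightarrow> 'x set \<Rightarrow> 'y set \<Rightarrow> 'm set \<Rightarrow> ('m \<Rightarrow> 'x) \<Rightarrow> ('m \<Rightarrow> 'y) \<Rightarrow> ('y \<Rightarrow> 'm filter) \<Rightarrow> bool" where
  "ultraspan u X Y M f g \<U> \<longleftrightarrow> small u M \<and> f \<in> M \<rightarrow> X \<and> ultrafamily M Y g \<U>"

text \<open>The ultramatrix corresponding to an ultraspan.\<close>

definition span_mat :: "'m set \<Rightarrow> ('m \<Rightarrow> 'x) \<Rightarrow> ('m \<Rightarrow> 'y) \<Rightarrow> 'x \<Rightarrow> 'y \<Rightarrow> 'm set" where
  "span_mat M f g x y = {m \<in> M. f m = x \<and> g m = y}"

definition span_mat_ultra :: "('m \<Rightarrow> 'x) \<Rightarrow> ('y \<Rightarrow> 'm filter) \<Rightarrow> 'y \<Rightarrow> ('x \<times> 'm) filter" where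
  "span_mat_ultra f \<U> y = filtermap (\<lambda>m. (f m, m)) (\<U> y)"

definition ultraspan_represents ::
  "'x set \<Rightarrow> 'y set \<Rightarrow> 'm set \<Rightarrow> ('m \<Rightarrow> 'x) \<Rightarrow> ('m \<Rightarrow> 'y) \<Rightarrow> ('y \<Rightarrow> 'm filter) \<Rightarrow> ('x, 'y, 'u) uesp \<Rightarrow> bool" where
  "ultraspan_represents X Y M f g \<U> F \<longleftrightarrow>
     ultraspan TYPE('u) X Y M f g \<U> \<and>
     ultramatrix_represents X Y (span_mat M f g) (span_mat_ultra f \<U>) F"

text \<open>The pullback of \<open>g\<close> and \<open>h\<close>; its projections are \<open>fst\<close> and \<open>snd\<close>.\<close>

definition span_apex :: "'m set \<Rightarrow> 'n set \<Rightarrow> ('m \<Rightarrow> 'y) \<Rightarrow> ('n \<Rightarrow> 'y) \<Rightarrow> ('m \<times> 'n) set" where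
  "span_apex M N g h = {(m, n) \<in> M \<times> N. g m = h n}"

text \<open>The inner \<open>filtermap\<close> is \<open>\<W>\<^sub>n\<close>, an ultrafilter on the fibre of \<open>snd\<close> over \<open>n\<close>.\<close>

definition span_ultra_comp ::
  "('n \<Rightarrow> 'y) \<Rightarrow> ('z \<Rightarrow> 'n filter) \<Rightarrow> ('y \<Rightarrow> 'm filter) \<Rightarrow> 'z \<Rightarrow> ('m \<times> 'n) filter" where
  "span_ultra_comp h \<V> \<U> z =
     filtermap snd (ultra_sum (\<V> z) (\<lambda>n. filtermap (\<lambda>m. (m, n)) (\<U> (h n))))"

end

theory Submission
  imports Defs
begin

text \<open>
  A partial map out of \<open>(A, \<U>)\<close> that is defined almost everywhere is a morphism to \<open>(H, \<W>)\<close> for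
  exactly one \<open>\<W>\<close>, its image of \<open>\<U>\<close>. Hence the integral of the functor represented by \<open>(A, \<U>)\<close> sends
  \<open>H\<close> to the reduced power of \<open>H\<close> modulo \<open>\<U>\<close>. A reduced power of reduced powers is the reduced power
  modulo the indexed sum of the ultrafilters, so the integral of a composite of represented one-cells
  is the integral of the functor represented by the composite ultramatrix. The integral reflects
  isomorphisms: a natural transformation between integrals commutes with the inclusions of large
  subfamilies, which forces it to preserve the ultrafilter indexing each summand.
\<close>


section \<open>Small sets\<close>

text \<open>Composition of one-cells is given only through the integral and only up to isomorphism,
  so a statement about a composite \<open>K\<close> is proved for \<open>integral X K\<close> and
  brought back. What makes this work is that the integral both preserves and reflects isomorphism.
  Reflection is the delicate half: the integral sees total maps of families, whereas morphisms of
  ultrafilters are partial maps up to agreement on a large set. The functors to be compared take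
  values in sets over different types. A reduced power is therefore not built as a quotient set; it
  is a property of a functor, being presented by sections modulo agreement almost everywhere. This
  property mentions the ultrafilter but not the family that carries it, so a change of matrix
  entries, from \<open>(y, n, m)\<close> to \<open>(m, n)\<close> or into \<open>'u\<close>, is a
  mere relabelling. A composite is obtained directly: the functor represented by the composite
  ultramatrix is a candidate, and uniqueness of reduced powers shows that its integral is correct.
  This is where power sets enter, since sets of ultrafilters and hom-sets have to be small.\<close>

lemma small_mono: "small u B \<Longrightarrow> A \<subseteq> B \<Longrightarrow> small u A"
  unfolding small_def by (rule ordLeq_ordLess_trans[OF card_of_mono1])

lemma small_image: "small u A \<Longrightarrow> small u (f ` A)"
  unfolding small_def by (rule ordLeq_ordLess_trans[OF card_of_image])

lemma small_inj_on:
  assumes "inj_on f A" "f ` A \<subseteq> B" "small u B"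
  shows "small u A"
proof -
  have "|A| \<le>o |B|" using assms(1,2) card_of_ordLeq[of A B] by blast
  then show ?thesis using assms(3) unfolding small_def by (rule ordLeq_ordLess_trans)
qed

lemma small_imp_embedding:
  assumes "small TYPE('u) A"
  shows "\<exists>i :: 'a \<Rightarrow> 'u. inj_on i A"
proof -
  have "|A| \<le>o |UNIV :: 'u set|"
    using assms unfolding small_def by (rule ordLess_imp_ordLeq)
  then show ?thesis using card_of_ordLeq[of A "UNIV :: 'u set"] by blast
qed

text \<open>The strong limit clause of the universe speaks of subsets of \<open>'u\<close> only, so
  \<open>A\<close> is replaced by its image under an embedding \<open>i\<close>; taking images under
  \<open>i\<close> embeds \<open>Pow A\<close> into the power set of that image.\<close>

lemma small_Pow:
  assumes u: "set_universe TYPE('u)" and A: "small TYPE('u) A"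
  shows "small TYPE('u) (Pow A)"
proof -
  obtain i :: "'a \<Rightarrow> 'u" where i: "inj_on i A"
    using small_imp_embedding[OF A] by blast
  have "small TYPE('u) (Pow (i ` A))"
    using u small_image[OF A, of i] unfolding set_universe_def by blast
  then show ?thesis
    by (rule small_inj_on[OF inj_on_image_Pow[OF i], rotated]) auto
qed

text \<open>An infinite regular cardinal is stable, and stability is closure under sums of fewer
  sets, each of smaller size. This is where regularity of the universe is used.\<close>

lemma small_Sigma:
  assumes u: "set_universe TYPE('u)" and A: "small TYPE('u) A"
    and B: "\<And>a. a \<in> A \<Longrightarrow> small TYPE('u) (B a)"
  shows "small TYPE('u) (Sigma A B)"
proof -
  have "stable |UNIV :: 'u set|"
    using u unfolding set_universe_def
    by (intro regularCard_stable card_of_Card_order) (auto simp: Field_card_of)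
  then show ?thesis
    using A B unfolding small_def by (rule stable_elim)
qed

lemma small_UN:
  assumes "set_universe TYPE('u)" "small TYPE('u) A" "\<And>a. a \<in> A \<Longrightarrow> small TYPE('u) (B a)"
  shows "small TYPE('u) (\<Union>a\<in>A. B a)"
proof -
  have "(\<Union>a\<in>A. B a) = snd ` Sigma A B" by force
  then show ?thesis using small_image[OF small_Sigma[OF assms]] by simp
qed


section \<open>Ultrafilters\<close>

lemma ultrafilter_on_large: "ultrafilter_on A \<U> \<Longrightarrow> large \<U> A"
  unfolding ultrafilter_on_def by (simp add: le_principal)

text \<open>The dichotomy for all predicates on the ambient type passes more easily through
  \<open>filtermap\<close> and \<open>ultra_sum\<close> than the one for subsets of
  \<open>A\<close>. The two agree because \<open>A\<close> itself is large;
  \<open>ultrafilter_on_cases\<close> is the way back.\<close>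

lemma ultrafilter_onI:
  assumes "large \<U> A" "\<U> \<noteq> bot" "\<And>P. eventually P \<U> \<or> (\<forall>\<^sub>F p in \<U>. \<not> P p)"
  shows "ultrafilter_on A \<U>"
  unfolding ultrafilter_on_def
proof (intro conjI allI impI)
  show "\<U> \<le> principal A" using assms(1) by (simp add: le_principal)
  fix W assume "W \<subseteq> A"
  show "large \<U> W \<or> large \<U> (A - W)"
    using assms(3)[of "\<lambda>p. p \<in> W"] assms(1) by (simp add: eventually_conj_iff)
qed (fact assms)

lemma ultrafilter_on_cases:
  assumes "ultrafilter_on A \<U>"
  shows "eventually P \<U> \<or> (\<forall>\<^sub>F p in \<U>. \<not> P p)"
proof -
  have "large \<U> {p \<in> A. P p} \<or> large \<U> (A - {p \<in> A. P p})"
    using assms unfolding ultrafilter_on_def by (elim conjE allE[of _ "{p \<in> A. P p}"]) auto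
  then show ?thesis
  proof
    assume "large \<U> {p \<in> A. P p}"
    then have "eventually P \<U>" by eventually_elim simp
    then show ?thesis ..
  next
    assume "large \<U> (A - {p \<in> A. P p})"
    then have "\<forall>\<^sub>F p in \<U>. \<not> P p" by eventually_elim simp
    then show ?thesis ..
  qed
qed

lemma ultrafilter_on_filtermap:
  assumes "ultrafilter_on A \<U>" "\<forall>\<^sub>F p in \<U>. f p \<in> B"
  shows "ultrafilter_on B (filtermap f \<U>)"
proof (rule ultrafilter_onI)
  show "filtermap f \<U> \<noteq> bot"
    using assms(1) by (simp add: filtermap_bot_iff ultrafilter_on_def)
  show "eventually P (filtermap f \<U>) \<or> (\<forall>\<^sub>F p in filtermap f \<U>. \<not> P p)" for P
    using ultrafilter_on_cases[OF assms(1), of "\<lambda>p. P (f p)"] by (simp add: eventually_filtermap)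
qed (use assms(2) in \<open>simp add: eventually_filtermap\<close>)

lemma ultrafilter_on_mono: "ultrafilter_on A \<U> \<Longrightarrow> large \<U> B \<Longrightarrow> ultrafilter_on B \<U>"
  using ultrafilter_on_filtermap[of A \<U> "\<lambda>p. p" B] by (simp add: filtermap_ident)

lemma ultrafilter_on_not_False: "ultrafilter_on A \<U> \<Longrightarrow> \<not> (\<forall>\<^sub>F p in \<U>. False)"
  by (simp add: ultrafilter_on_def trivial_limit_def)

text \<open>Ultrafilters are maximal: if \<open>P\<close> belonged to \<open>\<U>\<close> but not to
  \<open>\<V>\<close>, its complement would belong to \<open>\<V>\<close>, hence to the finer filter
  \<open>\<U>\<close>, which would contain the empty set.\<close>

lemma ultrafilter_on_le_imp_eq:
  assumes "ultrafilter_on A \<U>" "ultrafilter_on B \<V>" "\<U> \<le> \<V>"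
  shows "\<U> = \<V>"
proof (rule antisym)
  show "\<V> \<le> \<U>"
  proof (rule filter_leI)
    fix P assume P: "eventually P \<U>"
    have "\<not> (\<forall>\<^sub>F p in \<V>. \<not> P p)"
    proof
      assume "\<forall>\<^sub>F p in \<V>. \<not> P p"
      then have "\<forall>\<^sub>F p in \<U>. \<not> P p" by (rule filter_leD[OF assms(3)])
      with P have "\<forall>\<^sub>F p in \<U>. False" by eventually_elim simp
      then show False using ultrafilter_on_not_False[OF assms(1)] by simp
    qed
    then show "eventually P \<V>" using ultrafilter_on_cases[OF assms(2), of P] by blast
  qed
qed fact

text \<open>The outer ultrafilter decides whether almost every slice of \<open>P\<close> is large;
  if not, the inner ultrafilters move the negation inside, slice by slice.\<close>

lemma ultrafilter_on_ultra_sum: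
  assumes "ultrafilter_on A \<U>" "\<And>x. x \<in> A \<Longrightarrow> ultrafilter_on (B x) (\<V> x)"
  shows "ultrafilter_on (Sigma A B) (ultra_sum \<U> \<V>)"
proof (rule ultrafilter_onI)
  show "large (ultra_sum \<U> \<V>) (Sigma A B)"
    unfolding eventually_ultra_sum using ultrafilter_on_large[OF assms(1)]
  proof eventually_elim
    fix x assume "x \<in> A"
    then show "\<forall>\<^sub>F y in \<V> x. (x, y) \<in> Sigma A B"
      using ultrafilter_on_large[OF assms(2)] by simp
  qed
  have "\<not> (\<forall>\<^sub>F x in \<U>. \<forall>\<^sub>F y in \<V> x. False)"
  proof
    assume "\<forall>\<^sub>F x in \<U>. \<forall>\<^sub>F y in \<V> x. False"
    with ultrafilter_on_large[OF assms(1)] have "\<forall>\<^sub>F x in \<U>. False"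
      by eventually_elim (use assms(2) ultrafilter_on_not_False in blast)
    then show False using ultrafilter_on_not_False[OF assms(1)] by simp
  qed
  then show "ultra_sum \<U> \<V> \<noteq> bot"
    by (auto simp: trivial_limit_def eventually_ultra_sum)
  fix P
  show "eventually P (ultra_sum \<U> \<V>) \<or> (\<forall>\<^sub>F p in ultra_sum \<U> \<V>. \<not> P p)"
    unfolding eventually_ultra_sum
    using ultrafilter_on_cases[OF assms(1), of "\<lambda>x. \<forall>\<^sub>F y in \<V> x. P (x, y)"]
  proof
    assume "\<forall>\<^sub>F x in \<U>. \<not> (\<forall>\<^sub>F y in \<V> x. P (x, y))"
    with ultrafilter_on_large[OF assms(1)]
    have "\<forall>\<^sub>F x in \<U>. \<forall>\<^sub>F y in \<V> x. \<not> P (x, y)"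
    proof eventually_elim
      fix x assume "x \<in> A" "\<not> (\<forall>\<^sub>F y in \<V> x. P (x, y))"
      then show "\<forall>\<^sub>F y in \<V> x. \<not> P (x, y)"
        using ultrafilter_on_cases[OF assms(2), of x "\<lambda>y. P (x, y)"] by blast
    qed
    then show "(\<forall>\<^sub>F x in \<U>. \<forall>\<^sub>F y in \<V> x. P (x, y)) \<or>
      (\<forall>\<^sub>F x in \<U>. \<forall>\<^sub>F y in \<V> x. \<not> P (x, y))" ..
  qed simp
qed

lemma small_ultras:
  fixes X :: "'x set" and A :: "'x \<Rightarrow> 'a set"
  assumes u: "set_universe TYPE('u)" and X: "small TYPE('u) X"
    and A: "\<And>x. x \<in> X \<Longrightarrow> small TYPE('u) (A x)"
  shows "small TYPE('u) (ultras X A)"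
proof (rule small_inj_on)
  let ?S = "Sigma X A"
  show "small TYPE('u) (Pow (Pow ?S))"
    by (intro small_Pow[OF u] small_Sigma[OF u X] A)
  \<comment> \<open>A filter concentrated on \<open>?S\<close> is recovered from its large subsets
    of \<open>?S\<close>, so \<open>m\<close> embeds the ultrafilters into a double power
    set.\<close>
  define m where "m \<U> = {W \<in> Pow ?S. large \<U> W}" for \<U> :: "('x \<times> 'a) filter"
  show "m ` ultras X A \<subseteq> Pow (Pow ?S)" by (auto simp: m_def)
  have m: "eventually P \<U> \<longleftrightarrow> {p \<in> ?S. P p} \<in> m \<U>" if "\<U> \<in> ultras X A" for P \<U>
  proof -
    have "large \<U> ?S" using that by (simp add: ultras_def ultrafilter_on_large)
    then show ?thesis by (simp add: m_def eventually_conj_iff)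
  qed
  show "inj_on m (ultras X A)"
  proof (rule inj_onI)
    fix \<U> \<V> assume "\<U> \<in> ultras X A" "\<V> \<in> ultras X A" "m \<U> = m \<V>"
    then show "\<U> = \<V>" by (simp add: filter_eq_iff m)
  qed
qed


section \<open>Set-valued functors\<close>

text \<open>A functor to sets without size bound, whose arrows count only on elements of the value
  at the source. This covers hom-functors and integrals, which are neither small over
  \<open>'u\<close> nor built from extensional functions.\<close>

definition set_functor :: "('o, 'a) category \<Rightarrow> ('o, 'a, 'v set, 'v \<Rightarrow> 'v) ftr \<Rightarrow> bool" where
  "set_functor C P \<longleftrightarrow>
     (\<forall>a\<in>Obj C. \<forall>b\<in>Obj C. \<forall>f\<in>Hom C a b. \<forall>t\<in>fobj P a. farr P a b f t \<in> fobj P b) \<and>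
     (\<forall>a\<in>Obj C. \<forall>t\<in>fobj P a. farr P a a (Id C a) t = t) \<and>
     (\<forall>a\<in>Obj C. \<forall>b\<in>Obj C. \<forall>c\<in>Obj C. \<forall>f\<in>Hom C a b. \<forall>g\<in>Hom C b c. \<forall>t\<in>fobj P a.
        farr P a c (Comp C a b c g f) t = farr P b c g (farr P a b f t))"

lemma set_functor_mem:
  "set_functor C P \<Longrightarrow> a \<in> Obj C \<Longrightarrow> b \<in> Obj C \<Longrightarrow> f \<in> Hom C a b \<Longrightarrow> t \<in> fobj P a \<Longrightarrow>
   farr P a b f t \<in> fobj P b"
  unfolding set_functor_def by metis

lemma set_functor_Id:
  "set_functor C P \<Longrightarrow> a \<in> Obj C \<Longrightarrow> t \<in> fobj P a \<Longrightarrow> farr P a a (Id C a) t = t"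
  unfolding set_functor_def by metis

lemma set_functor_Comp:
  "set_functor C P \<Longrightarrow> a \<in> Obj C \<Longrightarrow> b \<in> Obj C \<Longrightarrow> c \<in> Obj C \<Longrightarrow> f \<in> Hom C a b \<Longrightarrow> g \<in> Hom C b c \<Longrightarrow>
   t \<in> fobj P a \<Longrightarrow> farr P a c (Comp C a b c g f) t = farr P b c g (farr P a b f t)"
  unfolding set_functor_def by metis

lemma is_functor_fobj: "is_functor C D F \<Longrightarrow> a \<in> Obj C \<Longrightarrow> fobj F a \<in> Obj D"
  unfolding is_functor_def by metis

lemma is_functor_farr:
  "is_functor C D F \<Longrightarrow> a \<in> Obj C \<Longrightarrow> b \<in> Obj C \<Longrightarrow> f \<in> Hom C a b \<Longrightarrow>
   farr F a b f \<in> Hom D (fobj F a) (fobj F b)"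
  unfolding is_functor_def by metis

lemma is_functor_Id:
  "is_functor C D F \<Longrightarrow> a \<in> Obj C \<Longrightarrow> farr F a a (Id C a) = Id D (fobj F a)"
  unfolding is_functor_def by metis

lemma is_functor_Comp:
  "is_functor C D F \<Longrightarrow> a \<in> Obj C \<Longrightarrow> b \<in> Obj C \<Longrightarrow> c \<in> Obj C \<Longrightarrow> f \<in> Hom C a b \<Longrightarrow> g \<in> Hom C b c \<Longrightarrow>
   farr F a c (Comp C a b c g f) =
   Comp D (fobj F a) (fobj F b) (fobj F c) (farr F b c g) (farr F a b f)"
  unfolding is_functor_def by metis

lemma Hom_fam_cat: "f \<in> Hom (fam_cat X) H K \<longleftrightarrow> (\<forall>x. f x \<in> H x \<rightarrow>\<^sub>E K x)"
  by (simp add: fam_cat_def)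

lemma Hom_fam_cat_mem: "f \<in> Hom (fam_cat X) H K \<Longrightarrow> a \<in> H x \<Longrightarrow> f x a \<in> K x"
  unfolding Hom_fam_cat by (blast intro: PiE_mem)

lemma Obj_fam_cat:
  fixes H :: "'x \<Rightarrow> 'u set"
  shows "H \<in> Obj (fam_cat X) \<longleftrightarrow> (\<forall>x\<in>X. small TYPE('u) (H x)) \<and> (\<forall>x. x \<notin> X \<longrightarrow> H x = {})"
  by (simp add: fam_cat_def)

lemma set_functor_at_index:
  assumes F: "is_functor C (fam_cat Y) F"
  shows "set_functor C (at_index F y)"
  unfolding set_functor_def
proof (intro conjI ballI)
  fix a b f t assume h: "a \<in> Obj C" "b \<in> Obj C" "f \<in> Hom C a b" "t \<in> fobj (at_index F y) a"
  show "farr (at_index F y) a b f t \<in> fobj (at_index F y) b"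
    using Hom_fam_cat_mem[OF is_functor_farr[OF F h(1-3)], of t y] h(4) by (simp add: at_index_def)
next
  fix a t assume h: "a \<in> Obj C" "t \<in> fobj (at_index F y) a"
  then show "farr (at_index F y) a a (Id C a) t = t"
    by (simp add: at_index_def is_functor_Id[OF F h(1)] fam_cat_def)
next
  fix a b c f g t
  assume h: "a \<in> Obj C" "b \<in> Obj C" "c \<in> Obj C" "f \<in> Hom C a b" "g \<in> Hom C b c"
    "t \<in> fobj (at_index F y) a"
  then show "farr (at_index F y) a c (Comp C a b c g f) t =
      farr (at_index F y) b c g (farr (at_index F y) a b f t)"
    by (simp add: at_index_def is_functor_Comp[OF F h(1-5)] fam_cat_def compose_eq)
qed

text \<open>\<open>set_iso\<close> alone does not say that \<open>P\<close> maps values to values;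
  this is what puts \<open>farr P a b f t\<close> in the domain where the inverse of
  \<open>\<alpha> b\<close> cancels \<open>\<alpha> b\<close>.\<close>

lemma set_iso_sym:
  assumes P: "set_functor C P" and iso: "set_iso C P Q"
  shows "set_iso C Q P"
proof -
  obtain \<alpha> where bij: "\<And>a. a \<in> Obj C \<Longrightarrow> bij_betw (\<alpha> a) (fobj P a) (fobj Q a)"
    and nat: "\<And>a b f t. a \<in> Obj C \<Longrightarrow> b \<in> Obj C \<Longrightarrow> f \<in> Hom C a b \<Longrightarrow> t \<in> fobj P a \<Longrightarrow>
      \<alpha> b (farr P a b f t) = farr Q a b f (\<alpha> a t)"
    using iso unfolding set_iso_def by metis
  define \<beta> where "\<beta> a = inv_into (fobj P a) (\<alpha> a)" for a
  show ?thesis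
    unfolding set_iso_def
  proof (intro exI[of _ \<beta>] conjI ballI)
    fix a assume "a \<in> Obj C"
    then show "bij_betw (\<beta> a) (fobj Q a) (fobj P a)"
      unfolding \<beta>_def by (rule bij_betw_inv_into[OF bij])
  next
    fix a b f u assume h: "a \<in> Obj C" "b \<in> Obj C" "f \<in> Hom C a b" "u \<in> fobj Q a"
    obtain t where t: "t \<in> fobj P a" "u = \<alpha> a t"
      using h(4) bij_betw_imp_surj_on[OF bij[OF h(1)]] by blast
    have \<beta>: "\<beta> c (\<alpha> c s) = s" if "c \<in> Obj C" "s \<in> fobj P c" for c s
      unfolding \<beta>_def by (rule bij_betw_inv_into_left[OF bij[OF that(1)] that(2)])
    show "\<beta> b (farr Q a b f u) = farr P a b f (\<beta> a u)"
      using nat[OF h(1-3) t(1)] \<beta>[OF h(1) t(1)] \<beta>[OF h(2) set_functor_mem[OF P h(1-3) t(1)]]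
      by (simp add: t(2))
  qed
qed

text \<open>Conjugates each arrow of \<open>P y\<close> by the encodings \<open>i\<close>: decode
  with \<open>inv_into\<close>, apply, encode. The restriction gives the extensional maps that
  \<open>fam_cat\<close> demands.\<close>

definition small_image_ftr ::
  "('y \<Rightarrow> 'o \<Rightarrow> 'v \<Rightarrow> 'u) \<Rightarrow> 'y set \<Rightarrow> ('y \<Rightarrow> ('o, 'a, 'v set, 'v \<Rightarrow> 'v) ftr) \<Rightarrow>
   ('o, 'a, 'y \<Rightarrow> 'u set, 'y \<Rightarrow> 'u \<Rightarrow> 'u) ftr" where
  "small_image_ftr i Y P =
     \<lparr>fobj = (\<lambda>a y. if y \<in> Y then i y a ` fobj (P y) a else {}),
      farr = (\<lambda>a b f y. restrict
        (\<lambda>t. i y b (farr (P y) a b f (inv_into (fobj (P y) a) (i y a) t)))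
        (if y \<in> Y then i y a ` fobj (P y) a else {}))\<rparr>"

text \<open>Arrows are conjugated by the embeddings into \<open>'u\<close>, so these can be chosen
  independently at each index and object. The result supplies both the intermediate functor of a
  composite and the composite one-cell itself.\<close>

lemma small_set_functors_imp_fam_functor:
  fixes P :: "'y \<Rightarrow> ('o, 'a, 'v set, 'v \<Rightarrow> 'v) ftr"
  assumes P: "\<And>y. y \<in> Y \<Longrightarrow> set_functor C (P y)"
    and small: "\<And>y a. y \<in> Y \<Longrightarrow> a \<in> Obj C \<Longrightarrow> small TYPE('u) (fobj (P y) a)"
  shows "\<exists>T :: ('o, 'a, 'y \<Rightarrow> 'u set, 'y \<Rightarrow> 'u \<Rightarrow> 'u) ftr.
    is_functor C (fam_cat Y) T \<and> (\<forall>y\<in>Y. set_iso C (at_index T y) (P y))"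
proof -
  define i where "i y a = (SOME j :: 'v \<Rightarrow> 'u. inj_on j (fobj (P y) a))" for y a
  have i: "inj_on (i y a) (fobj (P y) a)" if "y \<in> Y" "a \<in> Obj C" for y a
    unfolding i_def by (rule someI_ex[OF small_imp_embedding[OF small[OF that]]])
  let ?e = "\<lambda>y a. inv_into (fobj (P y) a) (i y a)"
  have e: "?e y a (i y a t) = t" if "y \<in> Y" "a \<in> Obj C" "t \<in> fobj (P y) a" for y a t
    by (rule inv_into_f_f[OF i[OF that(1,2)] that(3)])
  define T where "T = small_image_ftr i Y P"
  have fo: "fobj T a y = (if y \<in> Y then i y a ` fobj (P y) a else {})" for a y
    by (simp add: T_def small_image_ftr_def)
  have fa: "farr T a b f y (i y a t) = i y b (farr (P y) a b f t)"
    if "y \<in> Y" "a \<in> Obj C" "t \<in> fobj (P y) a" for a b f y t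
    using that by (simp add: T_def small_image_ftr_def e)
  have ext: "farr T a b f y \<in> extensional (fobj T a y)" for a b f y
    unfolding fo by (simp add: T_def small_image_ftr_def)
  have Hom: "farr T a b f \<in> Hom (fam_cat Y) (fobj T a) (fobj T b)"
    if "a \<in> Obj C" "b \<in> Obj C" "f \<in> Hom C a b" for a b f
    unfolding Hom_fam_cat PiE_def
  proof (intro allI IntI ext Pi_I)
    fix y t assume t: "t \<in> fobj T a y"
    then obtain s where s: "y \<in> Y" "s \<in> fobj (P y) a" "t = i y a s"
      by (auto simp: fo split: if_splits)
    show "farr T a b f y t \<in> fobj T b y"
      using set_functor_mem[OF P[OF s(1)] that s(2)] by (simp add: s fa that fo)
  qed
  have "is_functor C (fam_cat Y) T"
    unfolding is_functor_def
  proof (intro conjI ballI)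
    fix a assume a: "a \<in> Obj C"
    show "fobj T a \<in> Obj (fam_cat Y)"
      unfolding Obj_fam_cat using a by (auto simp: fo intro: small_image small)
    show "farr T a a (Id C a) = Id (fam_cat Y) (fobj T a)"
    proof
      fix y
      show "farr T a a (Id C a) y = Id (fam_cat Y) (fobj T a) y"
      proof (rule extensionalityI[OF ext])
        fix t assume "t \<in> fobj T a y"
        then obtain s where s: "y \<in> Y" "s \<in> fobj (P y) a" "t = i y a s"
          by (auto simp: fo split: if_splits)
        show "farr T a a (Id C a) y t = Id (fam_cat Y) (fobj T a) y t"
          by (simp add: s a fa set_functor_Id[OF P[OF s(1)] a s(2)] fam_cat_def fo)
      qed (simp add: fam_cat_def)
    qed
  next
    fix a b c f g
    assume h: "a \<in> Obj C" "b \<in> Obj C" "c \<in> Obj C" "f \<in> Hom C a b" "g \<in> Hom C b c"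
    show "farr T a c (Comp C a b c g f) =
      Comp (fam_cat Y) (fobj T a) (fobj T b) (fobj T c) (farr T b c g) (farr T a b f)"
    proof
      fix y
      show "farr T a c (Comp C a b c g f) y =
        Comp (fam_cat Y) (fobj T a) (fobj T b) (fobj T c) (farr T b c g) (farr T a b f) y"
      proof (rule extensionalityI[OF ext])
        fix t assume "t \<in> fobj T a y"
        then obtain s where s: "y \<in> Y" "s \<in> fobj (P y) a" "t = i y a s"
          by (auto simp: fo split: if_splits)
        have "farr (P y) a b f s \<in> fobj (P y) b"
          by (rule set_functor_mem[OF P[OF s(1)] h(1,2,4) s(2)])
        then show "farr T a c (Comp C a b c g f) y t =
          Comp (fam_cat Y) (fobj T a) (fobj T b) (fobj T c) (farr T b c g) (farr T a b f) y t"
          using s h set_functor_Comp[OF P[OF s(1)] h s(2)]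
          by (simp add: fam_cat_def compose_eq fo fa)
      qed (simp add: fam_cat_def)
    qed
  qed (rule Hom)
  moreover have "set_iso C (at_index T y) (P y)" if y: "y \<in> Y" for y
    unfolding set_iso_def
  proof (intro exI[of _ "?e y"] conjI ballI)
    fix a assume a: "a \<in> Obj C"
    show "bij_betw (?e y a) (fobj (at_index T y) a) (fobj (P y) a)"
      using bij_betw_inv_into[OF inj_on_imp_bij_betw[OF i[OF y a]]] y by (simp add: at_index_def fo)
  next
    fix a b f t assume h: "a \<in> Obj C" "b \<in> Obj C" "f \<in> Hom C a b" "t \<in> fobj (at_index T y) a"
    then obtain s where s: "s \<in> fobj (P y) a" "t = i y a s"
      using y by (auto simp: at_index_def fo)
    show "?e y b (farr (at_index T y) a b f t) = farr (P y) a b f (?e y a t)"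
      using set_functor_mem[OF P[OF y] h(1-3) s(1)] by (simp add: at_index_def s y h fa e)
  qed
  ultimately show ?thesis by blast
qed


section \<open>Maps of ultrafilters\<close>

lemma Obj_uf_cat: "c \<in> Obj (uf_cat X) \<longleftrightarrow> fst c \<in> Obj (fam_cat X) \<and> snd c \<in> ultras X (fst c)"
  by (auto simp: uf_cat_def)

lemma Hom_uf_cat: "Hom (uf_cat X) = uf_hom X"
  by (simp add: uf_cat_def)

lemma ultras_large: "\<U> \<in> ultras X A \<Longrightarrow> large \<U> (Sigma X A)"
  by (simp add: ultras_def ultrafilter_on_large)

text \<open>A partial map read as a total function over the index set, with junk off its domain. It
  turns the image of an ultrafilter into a \<open>filtermap\<close>.\<close>

definition pmap_fun :: "('x, 'a, 'b) pmap \<Rightarrow> 'x \<times> 'a \<Rightarrow> 'x \<times> 'b" where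
  "pmap_fun f p = (fst p, the (f p))"

lemma filter_eq_large:
  assumes "large F S" "large G S" "\<And>W. W \<subseteq> S \<Longrightarrow> large F W \<longleftrightarrow> large G W"
  shows "F = G"
  unfolding filter_eq_iff
proof
  fix P
  have "eventually P F \<longleftrightarrow> large F {p \<in> S. P p}" "eventually P G \<longleftrightarrow> large G {p \<in> S. P p}"
    using assms(1,2) by (simp_all add: eventually_conj_iff)
  then show "eventually P F \<longleftrightarrow> eventually P G" using assms(3)[of "{p \<in> S. P p}"] by simp
qed

lemma eventually_iff_if:
  assumes "\<forall>\<^sub>F p in F. P p \<longleftrightarrow> Q p"
  shows "eventually P F \<longleftrightarrow> eventually Q F"
proof
  assume "eventually P F" with assms show "eventually Q F" by eventually_elim simp
next
  assume "eventually Q F" with assms show "eventually P F" by eventually_elim simp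
qed

lemma filtermap_eventually_cong:
  assumes "\<forall>\<^sub>F p in F. f p = g p"
  shows "filtermap f F = filtermap g F"
  unfolding filter_eq_iff eventually_filtermap
proof
  fix P
  show "(\<forall>\<^sub>F p in F. P (f p)) \<longleftrightarrow> (\<forall>\<^sub>F p in F. P (g p))"
    by (rule eventually_iff_if) (use assms in \<open>eventually_elim, simp\<close>)
qed

text \<open>The preimage condition says that two filters have the same large subsets of
  \<open>Sigma X (fst d)\<close>. Both are concentrated there, so it is an equality of filters: the
  target ultrafilter is the image of the source one.\<close>

lemma uf_maps_iff:
  assumes V: "large (snd d) (Sigma X (fst d))"
  shows "f \<in> uf_maps X c d \<longleftrightarrow>
    dom f \<subseteq> Sigma X (fst c) \<and> large (snd c) (dom f) \<and>
    (\<forall>x a b. f (x, a) = Some b \<longrightarrow> b \<in> fst d x) \<and> snd d = filtermap (pmap_fun f) (snd c)"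
proof -
  obtain A \<U> B \<V> where cd: "c = (A, \<U>)" "d = (B, \<V>)" by fastforce
  show ?thesis
  proof (cases "dom f \<subseteq> Sigma X A \<and> large \<U> (dom f) \<and> (\<forall>x a b. f (x, a) = Some b \<longrightarrow> b \<in> B x)")
    case True
    then have dom: "dom f \<subseteq> Sigma X A" "large \<U> (dom f)"
      and val: "\<And>x a b. f (x, a) = Some b \<Longrightarrow> b \<in> B x" by blast+
    have "large \<U> {p. pmap_fun f p \<in> Sigma X B}"
      using dom(2)
    proof eventually_elim
      fix p assume p: "p \<in> dom f"
      obtain x a where "p = (x, a)" by fastforce
      with p dom(1) val show "p \<in> {p. pmap_fun f p \<in> Sigma X B}"
        by (auto simp: pmap_fun_def)
    qed
    then have fm: "large (filtermap (pmap_fun f) \<U>) (Sigma X B)"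
      by (simp add: eventually_filtermap)
    \<comment> \<open>The two conditions may differ off \<open>dom f\<close>, where
      \<open>pmap_fun\<close> has a junk value, but \<open>dom f\<close> is large.\<close>
    have pre: "large \<U> (pmap_preimage f W) \<longleftrightarrow> large (filtermap (pmap_fun f) \<U>) W" for W
      unfolding eventually_filtermap
    proof (rule eventually_iff_if)
      show "\<forall>\<^sub>F p in \<U>. (p \<in> pmap_preimage f W) = (pmap_fun f p \<in> W)"
        using dom(2) by eventually_elim (auto simp: pmap_preimage_def pmap_fun_def)
    qed
    have "(\<forall>W\<subseteq>Sigma X B. large \<V> W \<longleftrightarrow> large (filtermap (pmap_fun f) \<U>) W) \<longleftrightarrow>
      \<V> = filtermap (pmap_fun f) \<U>"
      using filter_eq_large[OF _ fm, of \<V>] V by (auto simp: cd)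
    then show ?thesis
      using True by (auto simp: uf_maps_def cd pre)
  next
    case False
    then show ?thesis unfolding uf_maps_def cd by auto
  qed
qed

lemma uf_maps_large_dom: "f \<in> uf_maps X c d \<Longrightarrow> large (snd c) (dom f)"
  by (auto simp: uf_maps_def split: prod.splits)

lemma uf_eq_iff:
  "(f, g) \<in> uf_eq X c d \<longleftrightarrow>
   f \<in> uf_maps X c d \<and> g \<in> uf_maps X c d \<and> (\<forall>\<^sub>F p in snd c. f p = g p)"
proof
  assume "(f, g) \<in> uf_eq X c d"
  then obtain W where "f \<in> uf_maps X c d" "g \<in> uf_maps X c d" and
    W: "large (snd c) W" "\<forall>p\<in>W. f p = g p"
    unfolding uf_eq_def by blast
  moreover have "\<forall>\<^sub>F p in snd c. f p = g p"
    using W(1) by eventually_elim (simp add: W(2))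
  ultimately show "f \<in> uf_maps X c d \<and> g \<in> uf_maps X c d \<and> (\<forall>\<^sub>F p in snd c. f p = g p)"
    by blast
next
  assume h: "f \<in> uf_maps X c d \<and> g \<in> uf_maps X c d \<and> (\<forall>\<^sub>F p in snd c. f p = g p)"
  \<comment> \<open>Agreement almost everywhere also counts points where both maps are undefined.
    The witness has to avoid these, and stays large because both domains are.\<close>
  let ?W = "{p \<in> dom f \<inter> dom g. f p = g p}"
  have "large (snd c) (dom f)" "large (snd c) (dom g)" "\<forall>\<^sub>F p in snd c. f p = g p"
    using h by (auto simp: uf_maps_large_dom)
  then have "large (snd c) ?W" by eventually_elim blast
  with h show "(f, g) \<in> uf_eq X c d"
    unfolding uf_eq_def by (auto intro!: exI[of _ ?W])
qed

lemma equiv_uf_eq: "equiv (uf_maps X c d) (uf_eq X c d)"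
proof (rule equivI)
  show "sym (uf_eq X c d)" unfolding sym_def uf_eq_iff by (simp add: eq_commute)
  show "trans (uf_eq X c d)"
    unfolding trans_def uf_eq_iff
  proof (intro allI impI conjI; elim conjE)
    fix f g h assume "\<forall>\<^sub>F p in snd c. f p = g p" "\<forall>\<^sub>F p in snd c. g p = h p"
    then show "\<forall>\<^sub>F p in snd c. f p = h p" by eventually_elim simp
  qed
qed (auto simp: refl_on_def uf_eq_iff)

lemma uf_class_mem: "g \<in> uf_class X c d f \<longleftrightarrow> (f, g) \<in> uf_eq X c d"
  by (simp add: uf_class_def)

lemma uf_class_eq:
  assumes "f \<in> uf_maps X c d" "g \<in> uf_maps X c d"
  shows "uf_class X c d f = uf_class X c d g \<longleftrightarrow> (\<forall>\<^sub>F p in snd c. f p = g p)"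
  unfolding uf_class_def eq_equiv_class_iff[OF equiv_uf_eq assms] uf_eq_iff using assms by simp

lemma uf_hom_eq: "uf_hom X c d = uf_class X c d ` uf_maps X c d"
  by (auto simp: uf_hom_def quotient_def uf_class_def)

lemma uf_hom_cases:
  assumes "k \<in> uf_hom X c d"
  obtains f where "f \<in> uf_maps X c d" "k = uf_class X c d f"
  using assms by (auto simp: uf_hom_eq)

section \<open>Composition of classes of partial maps\<close>

lemma pmap_comp_apply: "pmap_comp g f p = Option.bind (f p) (\<lambda>b. g (fst p, b))"
  by (cases p) (simp add: pmap_comp_def)

lemma pmap_comp_assoc: "pmap_comp h (pmap_comp g f) = pmap_comp (pmap_comp h g) f"
  by (rule ext) (simp add: pmap_comp_apply split: bind_split)

lemma eventually_pmap_fun: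
  assumes "f \<in> uf_maps X c d" "large (snd d) (Sigma X (fst d))" "eventually P (snd d)"
  shows "\<forall>\<^sub>F p in snd c. P (pmap_fun f p)"
  using assms by (simp add: uf_maps_iff eventually_filtermap)

lemma pmap_comp_maps:
  assumes f: "f \<in> uf_maps X c d" and g: "g \<in> uf_maps X d e"
    and d: "large (snd d) (Sigma X (fst d))" and e: "large (snd e) (Sigma X (fst e))"
  shows "pmap_comp g f \<in> uf_maps X c e"
  unfolding uf_maps_iff[OF e]
proof (intro conjI allI impI)
  have f': "dom f \<subseteq> Sigma X (fst c)" "snd d = filtermap (pmap_fun f) (snd c)"
    and g': "\<And>x a b. g (x, a) = Some b \<Longrightarrow> b \<in> fst e x" "snd e = filtermap (pmap_fun g) (snd d)"
    using f g by (simp_all add: uf_maps_iff[OF d] uf_maps_iff[OF e])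
  have df: "large (snd c) (dom f)" by (rule uf_maps_large_dom[OF f])
  have "dom (pmap_comp g f) \<subseteq> dom f"
    by (auto simp: pmap_comp_apply bind_eq_Some_conv)
  then show "dom (pmap_comp g f) \<subseteq> Sigma X (fst c)"
    using f'(1) by (rule subset_trans)
  show "large (snd c) (dom (pmap_comp g f))"
    using df eventually_pmap_fun[OF f d uf_maps_large_dom[OF g]]
    by eventually_elim (auto simp: pmap_comp_apply pmap_fun_def)
  show "b \<in> fst e x" if "pmap_comp g f (x, a) = Some b" for x a b
    using that g'(1) by (auto simp: pmap_comp_apply bind_eq_Some_conv)
  show "snd e = filtermap (pmap_fun (pmap_comp g f)) (snd c)"
    unfolding g'(2) f'(2) filtermap_filtermap
  proof (rule filtermap_eventually_cong)
    show "\<forall>\<^sub>F p in snd c. pmap_fun g (pmap_fun f p) = pmap_fun (pmap_comp g f) p"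
      using df by eventually_elim (auto simp: pmap_fun_def pmap_comp_apply)
  qed
qed

text \<open>All representatives give the same class, since agreement of \<open>g\<close> and
  \<open>g'\<close> almost everywhere for \<open>d\<close> pulls back along \<open>f\<close> to
  agreement almost everywhere for \<open>c\<close>. The union defining \<open>uf_comp\<close> is
  thus a nonempty union of copies of one class.\<close>

lemma uf_comp_class:
  assumes f: "f \<in> uf_maps X c d" and g: "g \<in> uf_maps X d e"
    and d: "large (snd d) (Sigma X (fst d))" and e: "large (snd e) (Sigma X (fst e))"
  shows "uf_comp X c e (uf_class X d e g) (uf_class X c d f) = uf_class X c e (pmap_comp g f)"
proof -
  have eq: "uf_class X c e (pmap_comp g' f') = uf_class X c e (pmap_comp g f)"
    if f': "f' \<in> uf_class X c d f" and g': "g' \<in> uf_class X d e g" for f' g'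
  proof -
    have m: "f' \<in> uf_maps X c d" "\<forall>\<^sub>F p in snd c. f p = f' p"
      "g' \<in> uf_maps X d e" "\<forall>\<^sub>F p in snd d. g p = g' p"
      using f' g' by (simp_all add: uf_class_mem uf_eq_iff)
    have "\<forall>\<^sub>F p in snd c. pmap_comp g' f' p = pmap_comp g f p"
      using m(2) uf_maps_large_dom[OF f] eventually_pmap_fun[OF f d m(4)]
    proof eventually_elim
      fix p assume eq: "f p = f' p" and p: "p \<in> dom f" and g: "g (pmap_fun f p) = g' (pmap_fun f p)"
      then obtain b where b: "f p = Some b" using domD[OF p] by blast
      with eq have "f' p = Some b" by simp
      with b g show "pmap_comp g' f' p = pmap_comp g f p"
        by (simp add: pmap_comp_apply pmap_fun_def)
    qed
    then show ?thesis
      by (subst uf_class_eq) (use pmap_comp_maps f g m(1,3) d e in blast)+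
  qed
  have "f \<in> uf_class X c d f" "g \<in> uf_class X d e g"
    using f g by (simp_all add: uf_class_mem uf_eq_iff)
  with eq show ?thesis unfolding uf_comp_def by blast
qed

lemma Comp_uf_cat: "Comp (uf_cat X) c d e k h = uf_comp X c e k h"
  by (simp add: uf_cat_def)

lemma uf_class_in_hom: "f \<in> uf_maps X c d \<Longrightarrow> uf_class X c d f \<in> uf_hom X c d"
  by (simp add: uf_hom_eq)

lemma total_pmap_apply:
  "total_pmap X A f p = (if p \<in> Sigma X A then Some (f (fst p) (snd p)) else None)"
  by (cases p) (simp add: total_pmap_def)

section \<open>Push-forward and total maps as morphisms\<close>

lemma push_eq: "push f \<U> = filtermap (\<lambda>p. (fst p, f (fst p) (snd p))) \<U>"
  by (simp add: push_def case_prod_beta')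

lemma push_ultras:
  assumes "f \<in> Hom (fam_cat X) H K" "\<U> \<in> ultras X H"
  shows "push f \<U> \<in> ultras X K"
  unfolding ultras_def push_eq mem_Collect_eq
proof (rule ultrafilter_on_filtermap)
  show "ultrafilter_on (Sigma X H) \<U>" using assms(2) by (simp add: ultras_def)
  show "\<forall>\<^sub>F p in \<U>. (fst p, f (fst p) (snd p)) \<in> Sigma X K"
    using ultras_large[OF assms(2)]
    by eventually_elim (auto intro: Hom_fam_cat_mem[OF assms(1)])
qed

lemma total_pmap_maps:
  assumes f: "f \<in> Hom (fam_cat X) H K" and \<U>: "\<U> \<in> ultras X H"
  shows "total_pmap X H f \<in> uf_maps X (H, \<U>) (K, push f \<U>)"
proof (subst uf_maps_iff)
  show "large (snd (K, push f \<U>)) (Sigma X (fst (K, push f \<U>)))"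
    using push_ultras[OF assms] by (simp add: ultras_large)
  have dom: "dom (total_pmap X H f) = Sigma X H"
    by (auto simp: total_pmap_apply dom_def)
  have "push f \<U> = filtermap (pmap_fun (total_pmap X H f)) \<U>"
    unfolding push_eq
  proof (rule filtermap_eventually_cong)
    show "\<forall>\<^sub>F p in \<U>. (fst p, f (fst p) (snd p)) = pmap_fun (total_pmap X H f) p"
      using ultras_large[OF \<U>] by eventually_elim (simp add: pmap_fun_def total_pmap_apply)
  qed
  then show "dom (total_pmap X H f) \<subseteq> Sigma X (fst (H, \<U>)) \<and>
    large (snd (H, \<U>)) (dom (total_pmap X H f)) \<and>
    (\<forall>x a b. total_pmap X H f (x, a) = Some b \<longrightarrow> b \<in> fst (K, push f \<U>) x) \<and>
    snd (K, push f \<U>) = filtermap (pmap_fun (total_pmap X H f)) (snd (H, \<U>))"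
    using ultras_large[OF \<U>]
    by (auto simp: dom total_pmap_apply intro: Hom_fam_cat_mem[OF f] split: if_splits)
qed

lemma total_pmap_id_maps:
  assumes "large (snd c) (Sigma X (fst c))"
  shows "total_pmap X (fst c) (\<lambda>x a. a) \<in> uf_maps X c c"
  unfolding uf_maps_iff[OF assms]
proof (intro conjI)
  let ?i = "total_pmap X (fst c) (\<lambda>x a. a)"
  have dom: "dom ?i = Sigma X (fst c)"
    by (auto simp: total_pmap_apply dom_def)
  show "dom ?i \<subseteq> Sigma X (fst c)" "large (snd c) (dom ?i)"
    using assms by (simp_all add: dom)
  show "\<forall>x a b. ?i (x, a) = Some b \<longrightarrow> b \<in> fst c x" by (simp add: total_pmap_apply)
  have "filtermap (\<lambda>p. p) (snd c) = filtermap (pmap_fun ?i) (snd c)"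
  proof (rule filtermap_eventually_cong)
    show "\<forall>\<^sub>F p in snd c. p = pmap_fun ?i p"
      using assms by eventually_elim (auto simp: pmap_fun_def total_pmap_apply)
  qed
  then show "snd c = filtermap (pmap_fun ?i) (snd c)" by (simp add: filtermap_ident)
qed

lemma Obj_uf_cat_large: "c \<in> Obj (uf_cat X) \<Longrightarrow> large (snd c) (Sigma X (fst c))"
  by (simp add: Obj_uf_cat ultras_large)

text \<open>Composition of partial maps is associative on the nose; the unit law is checked almost
  everywhere, which suffices for classes. The source \<open>c\<close> may have its own element type,
  so matrices with entries outside \<open>'u\<close> also have hom-functors.\<close>

lemma set_functor_uf_hom_ftr: "set_functor (uf_cat X) (uf_hom_ftr X c)"
  unfolding set_functor_def
proof (intro conjI ballI)
  fix d e k h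
  assume o: "d \<in> Obj (uf_cat X)" "e \<in> Obj (uf_cat X)"
    and k: "k \<in> Hom (uf_cat X) d e" and h: "h \<in> fobj (uf_hom_ftr X c) d"
  obtain f where f: "f \<in> uf_maps X c d" "h = uf_class X c d f"
    using h by (auto simp: uf_hom_ftr_def elim: uf_hom_cases)
  obtain g where g: "g \<in> uf_maps X d e" "k = uf_class X d e g"
    using k by (auto simp: Hom_uf_cat elim: uf_hom_cases)
  show "farr (uf_hom_ftr X c) d e k h \<in> fobj (uf_hom_ftr X c) e"
    using uf_class_in_hom[OF pmap_comp_maps[OF f(1) g(1) o[THEN Obj_uf_cat_large]]]
    by (simp add: uf_hom_ftr_def f(2) g(2) uf_comp_class[OF f(1) g(1) o[THEN Obj_uf_cat_large]])
next
  fix d h assume d: "d \<in> Obj (uf_cat X)" and h: "h \<in> fobj (uf_hom_ftr X c) d"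
  note ld = Obj_uf_cat_large[OF d]
  obtain f where f: "f \<in> uf_maps X c d" "h = uf_class X c d f"
    using h by (auto simp: uf_hom_ftr_def elim: uf_hom_cases)
  let ?i = "total_pmap X (fst d) (\<lambda>x a. a)"
  note i = total_pmap_id_maps[OF ld]
  have "\<forall>\<^sub>F p in snd c. pmap_comp ?i f p = f p"
    using eventually_pmap_fun[OF f(1) ld ld] uf_maps_large_dom[OF f(1)]
    by eventually_elim (auto simp: pmap_comp_apply total_pmap_apply pmap_fun_def)
  then have "uf_class X c d (pmap_comp ?i f) = uf_class X c d f"
    by (simp add: uf_class_eq[OF pmap_comp_maps[OF f(1) i ld ld] f(1)])
  then show "farr (uf_hom_ftr X c) d d (Id (uf_cat X) d) h = h"
    by (simp add: uf_hom_ftr_def uf_cat_def f(2) uf_comp_class[OF f(1) i ld ld])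
next
  fix d e e' k k' h
  assume o: "d \<in> Obj (uf_cat X)" "e \<in> Obj (uf_cat X)" "e' \<in> Obj (uf_cat X)"
    and k: "k \<in> Hom (uf_cat X) d e" and k': "k' \<in> Hom (uf_cat X) e e'"
    and h: "h \<in> fobj (uf_hom_ftr X c) d"
  note l = o[THEN Obj_uf_cat_large]
  obtain f where f: "f \<in> uf_maps X c d" "h = uf_class X c d f"
    using h by (auto simp: uf_hom_ftr_def elim: uf_hom_cases)
  obtain g where g: "g \<in> uf_maps X d e" "k = uf_class X d e g"
    using k by (auto simp: Hom_uf_cat elim: uf_hom_cases)
  obtain g' where g': "g' \<in> uf_maps X e e'" "k' = uf_class X e e' g'"
    using k' by (auto simp: Hom_uf_cat elim: uf_hom_cases)
  note gf = pmap_comp_maps[OF f(1) g(1) l(1,2)] and g'g = pmap_comp_maps[OF g(1) g'(1) l(2,3)]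
  show "farr (uf_hom_ftr X c) d e' (Comp (uf_cat X) d e e' k' k) h =
    farr (uf_hom_ftr X c) e e' k' (farr (uf_hom_ftr X c) d e k h)"
    by (simp add: uf_hom_ftr_def Comp_uf_cat f(2) g(2) g'(2) uf_comp_class[OF f(1) g(1) l(1,2)]
        uf_comp_class[OF g(1) g'(1) l(2,3)] uf_comp_class[OF gf g'(1) l(2,3)]
        uf_comp_class[OF f(1) g'g l(1,3)] pmap_comp_assoc)
qed

text \<open>A class is the image of a partial map, and a partial map is determined by its graph, a
  subset of a small set.\<close>

lemma small_uf_hom:
  fixes c :: "('x, 'a) ufobj" and d :: "('x, 'b) ufobj"
  assumes u: "set_universe TYPE('u)" and X: "small TYPE('u) X"
    and A: "\<And>x. x \<in> X \<Longrightarrow> small TYPE('u) (fst c x)" and B: "\<And>x. x \<in> X \<Longrightarrow> small TYPE('u) (fst d x)"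
  shows "small TYPE('u) (uf_hom X c d)"
  unfolding uf_hom_eq
proof (rule small_image, rule small_inj_on)
  let ?S = "Sigma X (fst c) \<times> (\<Union>x\<in>X. fst d x)"
  show "small TYPE('u) (Pow ?S)"
    by (rule small_Pow[OF u], rule small_Sigma[OF u small_Sigma[OF u X A] small_UN[OF u X B]])
  show "inj_on Map.graph (uf_maps X c d)"
  proof (rule inj_onI)
    fix f g :: "('x, 'a, 'b) pmap" assume eq: "Map.graph f = Map.graph g"
    show "f = g"
    proof
      fix p
      show "f p = g p"
      proof (cases "f p")
        case None
        have "g p = None"
        proof (rule ccontr)
          assume "g p \<noteq> None"
          then obtain b where "g p = Some b" by auto
          then have "(p, b) \<in> Map.graph f" unfolding eq by (rule Map.in_graphI)
          then show False using None by (auto dest: Map.in_graphD)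
        qed
        with None show ?thesis by simp
      next
        case (Some b)
        then have "(p, b) \<in> Map.graph g" unfolding eq[symmetric] by (rule Map.in_graphI)
        then show ?thesis using Some by (auto dest: Map.in_graphD)
      qed
    qed
  qed
  show "Map.graph ` uf_maps X c d \<subseteq> Pow ?S"
  proof (intro image_subsetI PowI subsetI)
    fix f q assume f: "f \<in> uf_maps X c d" and "q \<in> Map.graph f"
    then obtain x a b where q: "q = ((x, a), b)" "f (x, a) = Some b"
      unfolding Map.graph_def by auto
    have "(x, a) \<in> Sigma X (fst c)" "b \<in> fst d x"
      using f q(2) by (auto simp: uf_maps_def split: prod.splits)
    then show "q \<in> ?S" by (auto simp: q(1))
  qed
qed


section \<open>The integral of a set-valued functor\<close>

text \<open>One component of \<open>integral\<close>, taken for values in any type so that it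
  applies to hom-functors as well.\<close>

definition uf_integral ::
  "'x set \<Rightarrow> (('x, 'u) ufobj, ('x, 'u, 'u) pmap set, 'v set, 'v \<Rightarrow> 'v) ftr \<Rightarrow>
   ('x \<Rightarrow> 'u set, 'x \<Rightarrow> 'u \<Rightarrow> 'u, (('x \<times> 'u) filter \<times> 'v) set,
    ('x \<times> 'u) filter \<times> 'v \<Rightarrow> ('x \<times> 'u) filter \<times> 'v) ftr" where
  "uf_integral X P =
     \<lparr>fobj = (\<lambda>H. SIGMA \<U>:ultras X H. fobj P (H, \<U>)),
      farr = (\<lambda>H K f. restrict
        (\<lambda>(\<U>, t). (push f \<U>,
           farr P (H, \<U>) (K, push f \<U>)
             (uf_class X (H, \<U>) (K, push f \<U>) (total_pmap X H f)) t))
        (SIGMA \<U>:ultras X H. fobj P (H, \<U>)))\<rparr>"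

lemma at_index_integral: "at_index (integral X F) y = uf_integral X (at_index F y)"
  by (simp add: at_index_def integral_def uf_integral_def)

lemma fobj_uf_integral: "fobj (uf_integral X P) H = (SIGMA \<U>:ultras X H. fobj P (H, \<U>))"
  by (simp add: uf_integral_def)

lemma farr_uf_integral:
  "\<U> \<in> ultras X H \<Longrightarrow> t \<in> fobj P (H, \<U>) \<Longrightarrow>
   farr (uf_integral X P) H K f (\<U>, t) =
     (push f \<U>, farr P (H, \<U>) (K, push f \<U>)
       (uf_class X (H, \<U>) (K, push f \<U>) (total_pmap X H f)) t)"
  by (simp add: uf_integral_def)

lemma uf_catI: "H \<in> Obj (fam_cat X) \<Longrightarrow> \<U> \<in> ultras X H \<Longrightarrow> (H, \<U>) \<in> Obj (uf_cat X)"
  by (simp add: Obj_uf_cat)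

lemma total_class_Hom:
  assumes "f \<in> Hom (fam_cat X) H K" "\<U> \<in> ultras X H"
  shows "uf_class X (H, \<U>) (K, push f \<U>) (total_pmap X H f) \<in> Hom (uf_cat X) (H, \<U>) (K, push f \<U>)"
  unfolding Hom_uf_cat by (rule uf_class_in_hom[OF total_pmap_maps[OF assms]])

text \<open>Both \<open>push\<close> and \<open>total_pmap\<close> respect identities and
  composition, so functoriality of \<open>P\<close> carries over summand by summand. The identities
  between push-forwards hold because the functions agree on \<open>Sigma X H\<close>, which is
  large.\<close>

lemma set_functor_uf_integral:
  assumes P: "set_functor (uf_cat X) P"
  shows "set_functor (fam_cat X) (uf_integral X P)"
  unfolding set_functor_def
proof (intro conjI ballI)
  fix H K f p
  assume h: "H \<in> Obj (fam_cat X)" "K \<in> Obj (fam_cat X)" "f \<in> Hom (fam_cat X) H K"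
    and p: "p \<in> fobj (uf_integral X P) H"
  obtain \<U> t where p': "p = (\<U>, t)" "\<U> \<in> ultras X H" "t \<in> fobj P (H, \<U>)"
    using p by (auto simp: fobj_uf_integral)
  note pu = push_ultras[OF h(3) p'(2)]
  show "farr (uf_integral X P) H K f p \<in> fobj (uf_integral X P) K"
    using set_functor_mem[OF P uf_catI[OF h(1) p'(2)] uf_catI[OF h(2) pu]
        total_class_Hom[OF h(3) p'(2)] p'(3)]
    by (simp add: p'(1) farr_uf_integral[OF p'(2,3)] fobj_uf_integral pu)
next
  fix H p assume h: "H \<in> Obj (fam_cat X)" and p: "p \<in> fobj (uf_integral X P) H"
  obtain \<U> t where p': "p = (\<U>, t)" "\<U> \<in> ultras X H" "t \<in> fobj P (H, \<U>)"
    using p by (auto simp: fobj_uf_integral)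
  have Id: "Id (fam_cat X) H = (\<lambda>x. restrict id (H x))" by (simp add: fam_cat_def)
  have "push (Id (fam_cat X) H) \<U> = filtermap (\<lambda>p. p) \<U>"
    unfolding push_eq Id
  proof (rule filtermap_eventually_cong)
    show "\<forall>\<^sub>F p in \<U>. (fst p, restrict id (H (fst p)) (snd p)) = p"
      using ultras_large[OF p'(2)] by eventually_elim auto
  qed
  then have push: "push (Id (fam_cat X) H) \<U> = \<U>" by (simp add: filtermap_ident)
  have "total_pmap X H (Id (fam_cat X) H) = total_pmap X H (\<lambda>x a. a)"
    by (rule ext) (auto simp: total_pmap_apply Id)
  then have "uf_class X (H, \<U>) (H, \<U>) (total_pmap X H (Id (fam_cat X) H)) = Id (uf_cat X) (H, \<U>)"
    by (simp add: uf_cat_def)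
  then show "farr (uf_integral X P) H H (Id (fam_cat X) H) p = p"
    by (simp add: p'(1) farr_uf_integral[OF p'(2,3)] push
        set_functor_Id[OF P uf_catI[OF h p'(2)] p'(3)])
next
  fix H K L f g p
  assume h: "H \<in> Obj (fam_cat X)" "K \<in> Obj (fam_cat X)" "L \<in> Obj (fam_cat X)"
    and f: "f \<in> Hom (fam_cat X) H K" and g: "g \<in> Hom (fam_cat X) K L"
    and p: "p \<in> fobj (uf_integral X P) H"
  obtain \<U> t where p': "p = (\<U>, t)" "\<U> \<in> ultras X H" "t \<in> fobj P (H, \<U>)"
    using p by (auto simp: fobj_uf_integral)
  let ?gf = "Comp (fam_cat X) H K L g f"
  have gf: "?gf = (\<lambda>x. compose (H x) (g x) (f x))" by (simp add: fam_cat_def)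
  note fU = push_ultras[OF f p'(2)]
  note gfU = push_ultras[OF g fU]
  have push: "push ?gf \<U> = push g (push f \<U>)"
    unfolding push_eq filtermap_filtermap gf
  proof (rule filtermap_eventually_cong)
    show "\<forall>\<^sub>F p in \<U>. (fst p, compose (H (fst p)) (g (fst p)) (f (fst p)) (snd p)) =
      (fst (fst p, f (fst p) (snd p)), g (fst (fst p, f (fst p) (snd p))) (snd (fst p, f (fst p) (snd p))))"
      using ultras_large[OF p'(2)] by eventually_elim (auto simp: compose_eq)
  qed
  have total: "total_pmap X H ?gf = pmap_comp (total_pmap X K g) (total_pmap X H f)"
    by (rule ext) (auto simp: total_pmap_apply pmap_comp_apply gf compose_eq Hom_fam_cat_mem[OF f])
  note o = uf_catI[OF h(1) p'(2)] uf_catI[OF h(2) fU] uf_catI[OF h(3) gfU]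
  note m = total_pmap_maps[OF f p'(2)] total_pmap_maps[OF g fU]
  note c = uf_comp_class[OF m o(2,3)[THEN Obj_uf_cat_large]]
  note ft = set_functor_mem[OF P o(1,2) total_class_Hom[OF f p'(2)] p'(3)]
  show "farr (uf_integral X P) H L ?gf p =
    farr (uf_integral X P) K L g (farr (uf_integral X P) H K f p)"
    using set_functor_Comp[OF P o total_class_Hom[OF f p'(2)] total_class_Hom[OF g fU] p'(3)]
    by (simp add: p'(1) farr_uf_integral[OF p'(2,3)] farr_uf_integral[OF fU ft] push total
        Comp_uf_cat c)
qed

text \<open>The isomorphism acts inside each summand and leaves the ultrafilter alone; naturality
  follows because the summand reached, \<open>push f \<U>\<close>, is the same on both
  sides.\<close>

lemma set_iso_uf_integral:
  fixes P :: "(('x, 'u) ufobj, ('x, 'u, 'u) pmap set, 'v set, 'v \<Rightarrow> 'v) ftr"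
    and Q :: "(('x, 'u) ufobj, ('x, 'u, 'u) pmap set, 'w set, 'w \<Rightarrow> 'w) ftr"
  assumes iso: "set_iso (uf_cat X) P Q"
  shows "set_iso (fam_cat X) (uf_integral X P) (uf_integral X Q)"
proof -
  obtain \<alpha> where bij: "\<And>a. a \<in> Obj (uf_cat X) \<Longrightarrow> bij_betw (\<alpha> a) (fobj P a) (fobj Q a)"
    and nat: "\<And>a b f t. a \<in> Obj (uf_cat X) \<Longrightarrow> b \<in> Obj (uf_cat X) \<Longrightarrow> f \<in> Hom (uf_cat X) a b \<Longrightarrow>
      t \<in> fobj P a \<Longrightarrow> \<alpha> b (farr P a b f t) = farr Q a b f (\<alpha> a t)"
    using iso unfolding set_iso_def by metis
  let ?\<gamma> = "\<lambda>(H :: 'x \<Rightarrow> 'u set) (\<U>, t). (\<U>, \<alpha> (H, \<U>) t)"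
  show ?thesis
    unfolding set_iso_def
  proof (intro exI[of _ ?\<gamma>] conjI ballI)
    fix H :: "'x \<Rightarrow> 'u set" assume H: "H \<in> Obj (fam_cat X)"
    have b: "bij_betw (\<alpha> (H, \<U>)) (fobj P (H, \<U>)) (fobj Q (H, \<U>))" if "\<U> \<in> ultras X H" for \<U>
      by (rule bij[OF uf_catI[OF H that]])
    show "bij_betw (?\<gamma> H) (fobj (uf_integral X P) H) (fobj (uf_integral X Q) H)"
      unfolding bij_betw_def fobj_uf_integral
    proof
      show "inj_on (?\<gamma> H) (SIGMA \<U>:ultras X H. fobj P (H, \<U>))"
      proof (rule inj_onI)
        fix p q
        assume "p \<in> (SIGMA \<U>:ultras X H. fobj P (H, \<U>))" "q \<in> (SIGMA \<U>:ultras X H. fobj P (H, \<U>))"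
          and eq: "?\<gamma> H p = ?\<gamma> H q"
        then obtain \<U> s t where "p = (\<U>, s)" "q = (\<U>, t)" "\<U> \<in> ultras X H"
          "s \<in> fobj P (H, \<U>)" "t \<in> fobj P (H, \<U>)" by auto
        with eq show "p = q"
          using inj_onD[OF bij_betw_imp_inj_on[OF b], of \<U> s t] by simp
      qed
      show "?\<gamma> H ` (SIGMA \<U>:ultras X H. fobj P (H, \<U>)) = (SIGMA \<U>:ultras X H. fobj Q (H, \<U>))"
      proof (intro subset_antisym subsetI)
        fix q assume "q \<in> (SIGMA \<U>:ultras X H. fobj Q (H, \<U>))"
        then obtain \<U> u where q: "q = (\<U>, u)" "\<U> \<in> ultras X H" "u \<in> fobj Q (H, \<U>)" by blast
        then obtain t where "t \<in> fobj P (H, \<U>)" "u = \<alpha> (H, \<U>) t"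
          using bij_betw_imp_surj_on[OF b[OF q(2)]] by blast
        with q show "q \<in> ?\<gamma> H ` (SIGMA \<U>:ultras X H. fobj P (H, \<U>))"
          by (intro image_eqI[of _ _ "(\<U>, t)"]) auto
      next
        fix q assume "q \<in> ?\<gamma> H ` (SIGMA \<U>:ultras X H. fobj P (H, \<U>))"
        then obtain \<U> t where "q = (\<U>, \<alpha> (H, \<U>) t)" "\<U> \<in> ultras X H" "t \<in> fobj P (H, \<U>)"
          by auto
        then show "q \<in> (SIGMA \<U>:ultras X H. fobj Q (H, \<U>))"
          using bij_betwE[OF b] by simp
      qed
    qed
  next
    fix H K f p
    assume h: "H \<in> Obj (fam_cat X)" "K \<in> Obj (fam_cat X)" "f \<in> Hom (fam_cat X) H K"
      and p: "p \<in> fobj (uf_integral X P) H"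
    obtain \<U> t where p': "p = (\<U>, t)" "\<U> \<in> ultras X H" "t \<in> fobj P (H, \<U>)"
      using p by (auto simp: fobj_uf_integral)
    note o = uf_catI[OF h(1) p'(2)] uf_catI[OF h(2) push_ultras[OF h(3) p'(2)]]
    have "\<alpha> (H, \<U>) t \<in> fobj Q (H, \<U>)"
      using bij_betwE[OF bij[OF o(1)]] p'(3) by blast
    then show "?\<gamma> K (farr (uf_integral X P) H K f p) = farr (uf_integral X Q) H K f (?\<gamma> H p)"
      by (simp add: p'(1) farr_uf_integral[OF p'(2)] p'(3)
          nat[OF o total_class_Hom[OF h(3) p'(2)] p'(3)])
  qed
qed

section \<open>The integral reflects isomorphisms\<close>

lemma Obj_fam_cat_mono:
  fixes H :: "'x \<Rightarrow> 'u set"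
  assumes "H \<in> Obj (fam_cat X)" "\<And>x. A x \<subseteq> H x"
  shows "A \<in> Obj (fam_cat X)"
proof -
  have "small TYPE('u) (A x)" if "x \<in> X" for x
    using assms(1) that by (intro small_mono[OF _ assms(2)]) (simp add: Obj_fam_cat)
  moreover have "A x = {}" if "x \<notin> X" for x
    using assms(1) assms(2)[of x] that by (simp add: Obj_fam_cat)
  ultimately show ?thesis by (simp add: Obj_fam_cat)
qed

text \<open>
  In the category of ultrafilters a large subfamily is isomorphic to the family containing it, so
  every map of ultrafilters is a total map preceded by the inverse of an inclusion.
\<close>

lemma uf_map_factor:
  fixes H :: "'x \<Rightarrow> 'u set" and L :: "'x \<Rightarrow> 'u set"
  assumes H: "H \<in> Obj (fam_cat X)" and U: "\<U> \<in> ultras X H"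
    and L: "(L, \<V>) \<in> Obj (uf_cat X)" and f: "f \<in> uf_maps X (H, \<U>) (L, \<V>)"
  obtains A \<iota> \<rho> g where "A \<in> Obj (fam_cat X)" "\<U> \<in> ultras X A" "Sigma X A = dom f"
    "\<iota> \<in> Hom (fam_cat X) A H" "push \<iota> \<U> = \<U>" "\<And>x a. a \<in> A x \<Longrightarrow> \<iota> x a = a"
    "\<rho> \<in> Hom (uf_cat X) (H, \<U>) (A, \<U>)"
    "g \<in> Hom (fam_cat X) A L" "push g \<U> = \<V>"
    "Comp (uf_cat X) (H, \<U>) (A, \<U>) (H, \<U>) (uf_class X (A, \<U>) (H, \<U>) (total_pmap X A \<iota>)) \<rho> =
       Id (uf_cat X) (H, \<U>)"
    "Comp (uf_cat X) (H, \<U>) (A, \<U>) (L, \<V>) (uf_class X (A, \<U>) (L, \<V>) (total_pmap X A g)) \<rho> =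
       uf_class X (H, \<U>) (L, \<V>) f"
    "Comp (uf_cat X) (A, \<U>) (H, \<U>) (L, \<V>) (uf_class X (H, \<U>) (L, \<V>) f)
       (uf_class X (A, \<U>) (H, \<U>) (total_pmap X A \<iota>)) = uf_class X (A, \<U>) (L, \<V>) (total_pmap X A g)"
proof -
  note Ll = Obj_uf_cat_large[OF L]
  have f': "dom f \<subseteq> Sigma X H" "large \<U> (dom f)" "\<And>x a b. f (x, a) = Some b \<Longrightarrow> b \<in> L x"
    "\<V> = filtermap (pmap_fun f) \<U>"
    using f by (auto simp: uf_maps_iff[OF Ll])
  \<comment> \<open>The domain of \<open>f\<close> as a subfamily of \<open>H\<close>. Being large,
    it carries the same filter \<open>\<U>\<close>, with no restriction to be taken.\<close>
  define A where "A x = {a. (x, a) \<in> dom f}" for x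
  have SA: "Sigma X A = dom f" using f'(1) by (auto simp: A_def)
  have AH: "A x \<subseteq> H x" for x using f'(1) by (auto simp: A_def)
  have A: "A \<in> Obj (fam_cat X)" by (rule Obj_fam_cat_mono[OF H AH])
  have UA: "\<U> \<in> ultras X A"
    using U f'(2) unfolding ultras_def mem_Collect_eq SA by (rule ultrafilter_on_mono)
  define \<iota> where "\<iota> x = restrict (\<lambda>a. a) (A x)" for x
  have \<iota>: "\<iota> \<in> Hom (fam_cat X) A H"
    unfolding Hom_fam_cat \<iota>_def using AH by auto
  have \<iota>': "\<iota> x a = a" if "a \<in> A x" for x a using that by (simp add: \<iota>_def)
  have "push \<iota> \<U> = filtermap (\<lambda>p. p) \<U>"
    unfolding push_eq
  proof (rule filtermap_eventually_cong)
    show "\<forall>\<^sub>F p in \<U>. (fst p, \<iota> (fst p) (snd p)) = p"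
      using ultras_large[OF UA] by eventually_elim (auto simp: \<iota>_def)
  qed
  then have p\<iota>: "push \<iota> \<U> = \<U>" by (simp add: filtermap_ident)
  \<comment> \<open>The identity on \<open>dom f\<close>. The same partial function serves as the
    inclusion from \<open>(A, \<U>)\<close> to \<open>(H, \<U>)\<close> and as its inverse; only the
    family regarded as source or target changes.\<close>
  define i where "i = total_pmap X A \<iota>"
  have i: "i p = (if p \<in> dom f then Some (snd p) else None)" for p
    using SA by (auto simp: i_def total_pmap_apply \<iota>_def)
  have i1: "i \<in> uf_maps X (A, \<U>) (H, \<U>)"
    using total_pmap_maps[OF \<iota> UA] by (simp add: p\<iota> i_def)
  have "filtermap (\<lambda>p. p) \<U> = filtermap (pmap_fun i) \<U>"
  proof (rule filtermap_eventually_cong)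
    show "\<forall>\<^sub>F p in \<U>. p = pmap_fun i p"
      using f'(2) by eventually_elim (simp add: pmap_fun_def i)
  qed
  then have fi: "\<U> = filtermap (pmap_fun i) \<U>" by (simp add: filtermap_ident)
  have di: "dom i = dom f" by (auto simp: i split: if_splits)
  have lA: "large (snd (A, \<U>)) (Sigma X (fst (A, \<U>)))" and lH: "large (snd (H, \<U>)) (Sigma X (fst (H, \<U>)))"
    using ultras_large[OF UA] ultras_large[OF U] by simp_all
  have i2: "i \<in> uf_maps X (H, \<U>) (A, \<U>)"
    unfolding uf_maps_iff[OF lA] using f'(1,2) fi by (auto simp: di i A_def split: if_splits)
  define g where "g x = restrict (\<lambda>a. the (f (x, a))) (A x)" for x
  have g: "g \<in> Hom (fam_cat X) A L"
    unfolding Hom_fam_cat g_def using f'(3) by (auto simp: A_def)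
  \<comment> \<open>Restricted to its own domain, \<open>f\<close> is total; hence composing with
    \<open>i\<close> on either side only relabels source and target.\<close>
  have tg: "total_pmap X A g = f"
  proof
    fix p :: "'x \<times> 'u"
    show "total_pmap X A g p = f p"
    proof (cases "p \<in> dom f")
      case True
      then show ?thesis using SA by (cases p) (auto simp: total_pmap_apply g_def)
    next
      case False
      then show ?thesis using SA by (auto simp: total_pmap_apply)
    qed
  qed
  have pg: "push g \<U> = \<V>"
    unfolding push_eq f'(4)
  proof (rule filtermap_eventually_cong)
    show "\<forall>\<^sub>F p in \<U>. (fst p, g (fst p) (snd p)) = pmap_fun f p"
      using f'(2)
    proof eventually_elim
      fix p assume "p \<in> dom f"
      then show "(fst p, g (fst p) (snd p)) = pmap_fun f p"
        by (simp add: pmap_fun_def g_def A_def)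
    qed
  qed
  have fA: "f \<in> uf_maps X (A, \<U>) (L, \<V>)"
    using total_pmap_maps[OF g UA] by (simp add: tg pg)
  let ?\<rho> = "uf_class X (H, \<U>) (A, \<U>) i"
  have fi': "pmap_comp f i = f"
    by (rule ext) (simp add: pmap_comp_apply i domIff)
  have c3: "Comp (uf_cat X) (A, \<U>) (H, \<U>) (L, \<V>) (uf_class X (H, \<U>) (L, \<V>) f)
      (uf_class X (A, \<U>) (H, \<U>) (total_pmap X A \<iota>)) = uf_class X (A, \<U>) (L, \<V>) (total_pmap X A g)"
    by (simp add: Comp_uf_cat tg i_def[symmetric] fi' uf_comp_class[OF i1 f lH Ll])
  from fi' have c1: "Comp (uf_cat X) (H, \<U>) (A, \<U>) (L, \<V>) (uf_class X (A, \<U>) (L, \<V>) (total_pmap X A g)) ?\<rho> =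
       uf_class X (H, \<U>) (L, \<V>) f"
    by (simp add: Comp_uf_cat tg uf_comp_class[OF i2 fA lA Ll])
  have "\<forall>\<^sub>F p in \<U>. pmap_comp i i p = total_pmap X H (\<lambda>x a. a) p"
    using f'(2)
  proof eventually_elim
    fix p assume p: "p \<in> dom f"
    then show "pmap_comp i i p = total_pmap X H (\<lambda>x a. a) p"
      using subsetD[OF f'(1) p] by (simp add: pmap_comp_apply i total_pmap_apply)
  qed
  then have "uf_class X (H, \<U>) (H, \<U>) (pmap_comp i i) = Id (uf_cat X) (H, \<U>)"
    using uf_class_eq[OF pmap_comp_maps[OF i2 i1 lA lH] total_pmap_id_maps[OF lH]]
    by (simp add: uf_cat_def)
  then have c2: "Comp (uf_cat X) (H, \<U>) (A, \<U>) (H, \<U>) (uf_class X (A, \<U>) (H, \<U>) (total_pmap X A \<iota>)) ?\<rho> =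
       Id (uf_cat X) (H, \<U>)"
    by (simp add: Comp_uf_cat i_def[symmetric] uf_comp_class[OF i2 i1 lA lH])
  show thesis
    using that[OF A UA SA \<iota> p\<iota> \<iota>' _ g pg c2 c1 c3] uf_class_in_hom[OF i2] by (simp add: Hom_uf_cat)
qed

text \<open>Once the ultrafilter index is preserved, bijectivity on the disjoint union gives
  bijectivity on each summand. Naturality is given for total maps only and is extended to all
  morphisms by \<open>uf_map_factor\<close>.\<close>

lemma set_iso_if_set_iso_uf_integral:
  fixes P :: "(('x, 'u) ufobj, ('x, 'u, 'u) pmap set, 'v set, 'v \<Rightarrow> 'v) ftr"
    and Q :: "(('x, 'u) ufobj, ('x, 'u, 'u) pmap set, 'w set, 'w \<Rightarrow> 'w) ftr"
  assumes P: "set_functor (uf_cat X) P" and Q: "set_functor (uf_cat X) Q"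
    and iso: "set_iso (fam_cat X) (uf_integral X P) (uf_integral X Q)"
  shows "set_iso (uf_cat X) P Q"
proof -
  let ?C = "fam_cat X :: ('x \<Rightarrow> 'u set, 'x \<Rightarrow> 'u \<Rightarrow> 'u) category"
  let ?D = "uf_cat X :: (('x, 'u) ufobj, ('x, 'u, 'u) pmap set) category"
  let ?cl = "\<lambda>A \<U> K f. uf_class X (A, \<U>) (K, push f \<U>) (total_pmap X A f)"
  obtain \<alpha> where bij: "\<And>H. H \<in> Obj ?C \<Longrightarrow>
      bij_betw (\<alpha> H) (fobj (uf_integral X P) H) (fobj (uf_integral X Q) H)"
    and nat: "\<And>H K f t. H \<in> Obj ?C \<Longrightarrow> K \<in> Obj ?C \<Longrightarrow> f \<in> Hom ?C H K \<Longrightarrow>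
      t \<in> fobj (uf_integral X P) H \<Longrightarrow>
      \<alpha> K (farr (uf_integral X P) H K f t) = farr (uf_integral X Q) H K f (\<alpha> H t)"
    using iso unfolding set_iso_def by metis
  have mem: "fst (\<alpha> H (\<U>, t)) \<in> ultras X H \<and>
      snd (\<alpha> H (\<U>, t)) \<in> fobj Q (H, fst (\<alpha> H (\<U>, t)))"
    if "H \<in> Obj ?C" "\<U> \<in> ultras X H" "t \<in> fobj P (H, \<U>)" for H \<U> t
  proof -
    have "\<alpha> H (\<U>, t) \<in> fobj (uf_integral X Q) H"
      using bij_betwE[OF bij[OF that(1)]] that(2,3) by (auto simp: fobj_uf_integral)
    then show ?thesis by (auto simp: fobj_uf_integral)
  qed
  \<comment> \<open>For each \<open>S\<close> in \<open>\<U>\<close>, the element \<open>t\<close>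
    comes from some \<open>t'\<close> over the subfamily cut out by \<open>S\<close>. By naturality
    the new index is pushed forward from that subfamily, so it contains \<open>S\<close> too, and
    comparable ultrafilters are equal.\<close>
  have fst: "fst (\<alpha> H (\<U>, t)) = \<U>"
    if H: "H \<in> Obj ?C" and U: "\<U> \<in> ultras X H" and t: "t \<in> fobj P (H, \<U>)" for H \<U> t
  proof -
    let ?W = "fst (\<alpha> H (\<U>, t))"
    have uW: "ultrafilter_on (Sigma X H) ?W" and uU: "ultrafilter_on (Sigma X H) \<U>"
      using mem[OF H U t] U by (simp_all add: ultras_def)
    have "?W \<le> \<U>"
    proof (rule filter_leI)
      fix S assume S: "eventually S \<U>"
      \<comment> \<open>The identity restricted to \<open>S\<close>; factoring this endomorphism
        yields the subfamily, its inclusion \<open>\<iota>\<close> and the inverse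
        \<open>\<rho>\<close>.\<close>
      define f where "f p = (if p \<in> Sigma X H \<and> S p then Some (snd p) else None)" for p
      have df: "dom f = {p \<in> Sigma X H. S p}" by (auto simp: f_def split: if_splits)
      have lf: "large \<U> (dom f)"
        using S ultras_large[OF U] by (simp add: df eventually_conj_iff)
      note HU = uf_catI[OF H U]
      have "filtermap (\<lambda>p. p) \<U> = filtermap (pmap_fun f) \<U>"
      proof (rule filtermap_eventually_cong)
        show "\<forall>\<^sub>F p in \<U>. p = pmap_fun f p"
          using lf unfolding df by eventually_elim (auto simp: pmap_fun_def f_def)
      qed
      then have "\<U> = filtermap (pmap_fun f) \<U>" by (simp add: filtermap_ident)
      then have f: "f \<in> uf_maps X (H, \<U>) (H, \<U>)"
        unfolding uf_maps_iff[OF Obj_uf_cat_large[OF HU]] using lf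
        by (auto simp: df) (auto simp: f_def split: if_splits)
      obtain A \<iota> \<rho> where A: "A \<in> Obj ?C" "\<U> \<in> ultras X A" "Sigma X A = dom f"
        and \<iota>: "\<iota> \<in> Hom ?C A H" "push \<iota> \<U> = \<U>" "\<And>x a. a \<in> A x \<Longrightarrow> \<iota> x a = a" and \<rho>: "\<rho> \<in> Hom ?D (H, \<U>) (A, \<U>)"
        and c: "Comp ?D (H, \<U>) (A, \<U>) (H, \<U>) (uf_class X (A, \<U>) (H, \<U>) (total_pmap X A \<iota>)) \<rho> =
          Id ?D (H, \<U>)"
        by (rule uf_map_factor[OF H U HU f]) blast
      note AU = uf_catI[OF A(1,2)]
      define t' where "t' = farr P (H, \<U>) (A, \<U>) \<rho> t"
      have t': "t' \<in> fobj P (A, \<U>)"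
        unfolding t'_def by (rule set_functor_mem[OF P HU AU \<rho> t])
      have cl: "uf_class X (A, \<U>) (H, \<U>) (total_pmap X A \<iota>) \<in> Hom ?D (A, \<U>) (H, \<U>)"
        using total_class_Hom[OF \<iota>(1) A(2)] by (simp only: \<iota>(2))
      have "farr P (A, \<U>) (H, \<U>) (uf_class X (A, \<U>) (H, \<U>) (total_pmap X A \<iota>)) t' = t"
        using set_functor_Comp[OF P HU AU HU \<rho> cl t, unfolded c]
        by (simp add: set_functor_Id[OF P HU t] t'_def)
      then have "farr (uf_integral X P) A H \<iota> (\<U>, t') = (\<U>, t)"
        by (simp add: farr_uf_integral[OF A(2) t'] \<iota>(2))
      then have "\<alpha> H (\<U>, t) = farr (uf_integral X Q) A H \<iota> (\<alpha> A (\<U>, t'))"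
        using nat[OF A(1) H \<iota>(1), of "(\<U>, t')"] A(2) t' by (simp add: fobj_uf_integral)
      then have W: "?W = push \<iota> (fst (\<alpha> A (\<U>, t')))"
        using mem[OF A(1,2) t'] farr_uf_integral[of "fst (\<alpha> A (\<U>, t'))" X A "snd (\<alpha> A (\<U>, t'))" Q H \<iota>]
        by simp
      have "large (fst (\<alpha> A (\<U>, t'))) (Sigma X A)"
        using mem[OF A(1,2) t'] by (simp add: ultras_large)
      then show "eventually S ?W"
        unfolding W push_eq eventually_filtermap
      proof eventually_elim
        fix p assume p: "p \<in> Sigma X A"
        then have "S p" using A(3) df by blast
        with p show "S (fst p, \<iota> (fst p) (snd p))" by (auto simp: \<iota>(3))
      qed
    qed
    then show ?thesis by (rule ultrafilter_on_le_imp_eq[OF uW uU])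
  qed
  define a where "a c t = snd (\<alpha> (fst c) (snd c, t))" for c t
  have \<alpha>: "\<alpha> H (\<U>, t) = (\<U>, a (H, \<U>) t)"
    if "H \<in> Obj ?C" "\<U> \<in> ultras X H" "t \<in> fobj P (H, \<U>)" for H \<U> t
    using fst[OF that] by (simp add: a_def prod_eq_iff)
  have aQ: "a (H, \<U>) t \<in> fobj Q (H, \<U>)"
    if "H \<in> Obj ?C" "\<U> \<in> ultras X H" "t \<in> fobj P (H, \<U>)" for H \<U> t
    using mem[OF that] by (simp add: \<alpha>[OF that])
  have a_total: "a (K, push g \<U>) (farr P (H, \<U>) (K, push g \<U>) (?cl H \<U> K g) t) =
      farr Q (H, \<U>) (K, push g \<U>) (?cl H \<U> K g) (a (H, \<U>) t)"
    if h: "H \<in> Obj ?C" "K \<in> Obj ?C" "g \<in> Hom ?C H K" "\<U> \<in> ultras X H" "t \<in> fobj P (H, \<U>)"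
    for H K g \<U> t
  proof -
    note gU = push_ultras[OF h(3,4)]
    have "farr P (H, \<U>) (K, push g \<U>) (?cl H \<U> K g) t \<in> fobj P (K, push g \<U>)"
      by (rule set_functor_mem[OF P uf_catI[OF h(1,4)] uf_catI[OF h(2) gU] total_class_Hom[OF h(3,4)] h(5)])
    then show ?thesis
      using nat[OF h(1-3), of "(\<U>, t)"] h(4,5)
      by (simp add: fobj_uf_integral farr_uf_integral[OF h(4)] \<alpha>[OF h(2) gU] \<alpha>[OF h(1,4,5)] aQ[OF h(1,4,5)])
  qed
  show ?thesis
    unfolding set_iso_def
  proof (intro exI[of _ a] conjI ballI)
    fix c assume "c \<in> Obj ?D"
    then obtain H \<U> where c: "c = (H, \<U>)" and H: "H \<in> Obj ?C" and U: "\<U> \<in> ultras X H"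
      by (cases c) (auto simp: Obj_uf_cat)
    show "bij_betw (a c) (fobj P c) (fobj Q c)"
      unfolding bij_betw_def
    proof
      show "inj_on (a c) (fobj P c)"
      proof (rule inj_onI)
        fix s t assume "s \<in> fobj P c" "t \<in> fobj P c" "a c s = a c t"
        then show "s = t"
          using inj_onD[OF bij_betw_imp_inj_on[OF bij[OF H]], of "(\<U>, s)" "(\<U>, t)"] U
          by (simp add: c \<alpha>[OF H U] fobj_uf_integral)
      qed
      show "a c ` fobj P c = fobj Q c"
      proof (intro subset_antisym subsetI)
        fix u assume u: "u \<in> fobj Q c"
        then have "(\<U>, u) \<in> \<alpha> H ` fobj (uf_integral X P) H"
          using bij_betw_imp_surj_on[OF bij[OF H]] U by (simp add: c fobj_uf_integral)
        \<comment> \<open>The index \<open>\<W>\<close> of the preimage is forced to be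
          \<open>\<U>\<close>, because \<open>\<alpha>\<close> preserves indices.\<close>
        then obtain \<W> t where "\<W> \<in> ultras X H" "t \<in> fobj P (H, \<W>)" "\<alpha> H (\<W>, t) = (\<U>, u)"
          by (auto simp: fobj_uf_integral)
        then show "u \<in> a c ` fobj P c"
          by (auto simp: \<alpha>[OF H] c)
      qed (auto simp: c aQ[OF H U])
    qed
  next
    fix c d k t
    assume cd: "c \<in> Obj ?D" "d \<in> Obj ?D" and k: "k \<in> Hom ?D c d" and t: "t \<in> fobj P c"
    obtain H \<U> where c: "c = (H, \<U>)" and H: "H \<in> Obj ?C" and U: "\<U> \<in> ultras X H"
      using cd(1) by (cases c) (auto simp: Obj_uf_cat)
    obtain L \<V> where d: "d = (L, \<V>)" and L: "L \<in> Obj ?C"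
      using cd(2) by (cases d) (auto simp: Obj_uf_cat)
    note HU = cd(1)[unfolded c] and LV = cd(2)[unfolded d] and t = t[unfolded c]
    obtain f where f: "f \<in> uf_maps X (H, \<U>) (L, \<V>)" and kf: "k = uf_class X (H, \<U>) (L, \<V>) f"
      using k by (auto simp: Hom_uf_cat c d elim: uf_hom_cases)
    obtain A \<iota> \<rho> g where A: "A \<in> Obj ?C" "\<U> \<in> ultras X A"
      and \<iota>: "\<iota> \<in> Hom ?C A H" "push \<iota> \<U> = \<U>" and \<rho>: "\<rho> \<in> Hom ?D (H, \<U>) (A, \<U>)"
      and g: "g \<in> Hom ?C A L" "push g \<U> = \<V>"
      and c1: "Comp ?D (H, \<U>) (A, \<U>) (H, \<U>) (uf_class X (A, \<U>) (H, \<U>) (total_pmap X A \<iota>)) \<rho> =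
        Id ?D (H, \<U>)"
      and c2: "Comp ?D (H, \<U>) (A, \<U>) (L, \<V>) (uf_class X (A, \<U>) (L, \<V>) (total_pmap X A g)) \<rho> = k"
      and c3: "Comp ?D (A, \<U>) (H, \<U>) (L, \<V>) k (uf_class X (A, \<U>) (H, \<U>) (total_pmap X A \<iota>)) =
        uf_class X (A, \<U>) (L, \<V>) (total_pmap X A g)"
      by (rule uf_map_factor[OF H U LV f, folded kf]) blast
    note AU = uf_catI[OF A] and k = k[unfolded c d]
    \<comment> \<open>Here \<open>t\<close> is the image of \<open>t'\<close> under the inclusion,
      and the inclusion followed by \<open>k\<close> is the class of the total map \<open>g\<close>.
      Naturality along \<open>k\<close> at \<open>t\<close> thus reduces to naturality along
      \<open>\<iota>\<close> and \<open>g\<close> at \<open>t'\<close>.\<close>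
    define t' where "t' = farr P (H, \<U>) (A, \<U>) \<rho> t"
    let ?i = "uf_class X (A, \<U>) (H, \<U>) (total_pmap X A \<iota>)"
    let ?g = "uf_class X (A, \<U>) (L, \<V>) (total_pmap X A g)"
    have i: "?i \<in> Hom ?D (A, \<U>) (H, \<U>)"
      using total_class_Hom[OF \<iota>(1) A(2)] by (simp only: \<iota>(2))
    have g': "?g \<in> Hom ?D (A, \<U>) (L, \<V>)"
      using total_class_Hom[OF g(1) A(2)] by (simp only: g(2))
    have t': "t' \<in> fobj P (A, \<U>)"
      unfolding t'_def by (rule set_functor_mem[OF P HU AU \<rho> t])
    have Pi: "farr P (A, \<U>) (H, \<U>) ?i t' = t"
      using set_functor_Comp[OF P HU AU HU \<rho> i t, unfolded c1]
      by (simp add: set_functor_Id[OF P HU t] t'_def)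
    have Pg: "farr P (A, \<U>) (L, \<V>) ?g t' = farr P (H, \<U>) (L, \<V>) k t"
      using set_functor_Comp[OF P HU AU LV \<rho> g' t, unfolded c2] by (simp add: t'_def)
    have ai: "a (H, \<U>) t = farr Q (A, \<U>) (H, \<U>) ?i (a (A, \<U>) t')"
      using a_total[OF A(1) H \<iota>(1) A(2) t'] by (simp only: \<iota>(2) Pi)
    have "a (L, \<V>) (farr P (H, \<U>) (L, \<V>) k t) = farr Q (A, \<U>) (L, \<V>) ?g (a (A, \<U>) t')"
      using a_total[OF A(1) L g(1) A(2) t'] by (simp only: g(2) Pg)
    also have "\<dots> = farr Q (H, \<U>) (L, \<V>) k (a (H, \<U>) t)"
      using set_functor_Comp[OF Q AU HU LV i k aQ[OF A t'], unfolded c3] by (simp only: ai)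
    finally show "a d (farr P c d k t) = farr Q c d k (a c t)" by (simp only: c d)
  qed
qed


section \<open>Reduced powers\<close>

text \<open>The condition holds almost everywhere, so the filter alone determines the sections; the
  family carrying the ultrafilter can be changed freely.\<close>

definition sections :: "('x \<Rightarrow> 'u set) \<Rightarrow> ('x \<times> 'a) filter \<Rightarrow> ('x \<times> 'a \<Rightarrow> 'u) set" where
  "sections H \<U> = {s. \<forall>\<^sub>F p in \<U>. s p \<in> H (fst p)}"

text \<open>
  An element of a reduced power is the germ of a partial section; it is represented here by a total
  function, whose values off a set in the ultrafilter are junk.
\<close>

definition reduced_power_map ::
  "'x set \<Rightarrow> ('x \<times> 'a) filter \<Rightarrow> ('x \<Rightarrow> 'u set, 'x \<Rightarrow> 'u \<Rightarrow> 'u, 'v set, 'v \<Rightarrow> 'v) ftr \<Rightarrow>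
   (('x \<Rightarrow> 'u set) \<Rightarrow> ('x \<times> 'a \<Rightarrow> 'u) \<Rightarrow> 'v) \<Rightarrow> bool" where
  "reduced_power_map X \<U> T q \<longleftrightarrow>
     (\<forall>H\<in>Obj (fam_cat X). q H ` sections H \<U> = fobj T H) \<and>
     (\<forall>H\<in>Obj (fam_cat X). \<forall>s\<in>sections H \<U>. \<forall>s'\<in>sections H \<U>.
        q H s = q H s' \<longleftrightarrow> (\<forall>\<^sub>F p in \<U>. s p = s' p)) \<and>
     (\<forall>H\<in>Obj (fam_cat X). \<forall>K\<in>Obj (fam_cat X). \<forall>f\<in>Hom (fam_cat X) H K. \<forall>s\<in>sections H \<U>.
        farr T H K f (q H s) = q K (\<lambda>p. f (fst p) (s p)))"

text \<open>Characterises \<open>T\<close> up to natural isomorphism by a presentation with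
  generators and relations, which lets functors with different value types be compared.\<close>

definition reduced_power ::
  "'x set \<Rightarrow> ('x \<times> 'a) filter \<Rightarrow> ('x \<Rightarrow> 'u set, 'x \<Rightarrow> 'u \<Rightarrow> 'u, 'v set, 'v \<Rightarrow> 'v) ftr \<Rightarrow> bool" where
  "reduced_power X \<U> T \<longleftrightarrow> (\<exists>q. reduced_power_map X \<U> T q)"

lemma reduced_powerI: "reduced_power_map X \<U> T q \<Longrightarrow> reduced_power X \<U> T"
  by (auto simp: reduced_power_def)

lemma reduced_power_map_image:
  "reduced_power_map X \<U> T q \<Longrightarrow> H \<in> Obj (fam_cat X) \<Longrightarrow> q H ` sections H \<U> = fobj T H"
  by (simp add: reduced_power_map_def)

lemma reduced_power_map_eq_iff:
  "reduced_power_map X \<U> T q \<Longrightarrow> H \<in> Obj (fam_cat X) \<Longrightarrow> s \<in> sections H \<U> \<Longrightarrow> s' \<in> sections H \<U> \<Longrightarrow>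
   q H s = q H s' \<longleftrightarrow> (\<forall>\<^sub>F p in \<U>. s p = s' p)"
  by (simp add: reduced_power_map_def)

lemma reduced_power_map_natural:
  "reduced_power_map X \<U> T q \<Longrightarrow> H \<in> Obj (fam_cat X) \<Longrightarrow> K \<in> Obj (fam_cat X) \<Longrightarrow>
   f \<in> Hom (fam_cat X) H K \<Longrightarrow> s \<in> sections H \<U> \<Longrightarrow>
   farr T H K f (q H s) = q K (\<lambda>p. f (fst p) (s p))"
  by (simp add: reduced_power_map_def)

lemma reduced_power_map_mem:
  "reduced_power_map X \<U> T q \<Longrightarrow> H \<in> Obj (fam_cat X) \<Longrightarrow> s \<in> sections H \<U> \<Longrightarrow> q H s \<in> fobj T H"
  by (simp flip: reduced_power_map_image)

lemma sections_map:
  assumes "s \<in> sections H \<U>" "f \<in> Hom (fam_cat X) H K"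
  shows "(\<lambda>p. f (fst p) (s p)) \<in> sections K \<U>"
proof -
  have "\<forall>\<^sub>F p in \<U>. s p \<in> H (fst p)" using assms(1) by (simp add: sections_def)
  then have "\<forall>\<^sub>F p in \<U>. f (fst p) (s p) \<in> K (fst p)"
    by eventually_elim (rule Hom_fam_cat_mem[OF assms(2)])
  then show ?thesis by (simp add: sections_def)
qed

lemma sections_cong:
  assumes "s \<in> sections H \<U>" "\<forall>\<^sub>F p in \<U>. s' p = s p"
  shows "s' \<in> sections H \<U>"
proof -
  have "\<forall>\<^sub>F p in \<U>. s p \<in> H (fst p)" using assms(1) by (simp add: sections_def)
  with assms(2) have "\<forall>\<^sub>F p in \<U>. s' p \<in> H (fst p)" by eventually_elim simp
  then show ?thesis by (simp add: sections_def)
qed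

section \<open>Invariance, uniqueness and reindexing of reduced powers\<close>

lemma reduced_power_set_iso:
  fixes T :: "('x \<Rightarrow> 'u set, 'x \<Rightarrow> 'u \<Rightarrow> 'u, 'v set, 'v \<Rightarrow> 'v) ftr"
    and T' :: "('x \<Rightarrow> 'u set, 'x \<Rightarrow> 'u \<Rightarrow> 'u, 'w set, 'w \<Rightarrow> 'w) ftr"
  assumes T: "reduced_power X \<U> T" and iso: "set_iso (fam_cat X) T T'"
  shows "reduced_power X \<U> T'"
proof -
  let ?C = "fam_cat X :: ('x \<Rightarrow> 'u set, 'x \<Rightarrow> 'u \<Rightarrow> 'u) category"
  obtain q where q: "reduced_power_map X \<U> T q" using T unfolding reduced_power_def ..
  obtain \<alpha> where bij: "\<And>a. a \<in> Obj ?C \<Longrightarrow> bij_betw (\<alpha> a) (fobj T a) (fobj T' a)"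
    and nat: "\<And>a b f t. a \<in> Obj ?C \<Longrightarrow> b \<in> Obj ?C \<Longrightarrow> f \<in> Hom ?C a b \<Longrightarrow> t \<in> fobj T a \<Longrightarrow>
      \<alpha> b (farr T a b f t) = farr T' a b f (\<alpha> a t)"
    using iso unfolding set_iso_def by metis
  have "reduced_power_map X \<U> T' (\<lambda>H s. \<alpha> H (q H s))"
    unfolding reduced_power_map_def
  proof (intro conjI ballI)
    fix H assume H: "H \<in> Obj ?C"
    have "(\<lambda>s. \<alpha> H (q H s)) ` sections H \<U> = \<alpha> H ` q H ` sections H \<U>"
      by (simp add: image_image)
    then show "(\<lambda>s. \<alpha> H (q H s)) ` sections H \<U> = fobj T' H"
      using bij_betw_imp_surj_on[OF bij[OF H]] by (simp add: reduced_power_map_image[OF q H])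
  next
    fix H s s' assume h: "H \<in> Obj ?C" "s \<in> sections H \<U>" "s' \<in> sections H \<U>"
    have "\<alpha> H (q H s) = \<alpha> H (q H s') \<longleftrightarrow> q H s = q H s'"
      by (rule inj_on_eq_iff[OF bij_betw_imp_inj_on[OF bij[OF h(1)]]])
        (fact reduced_power_map_mem[OF q h(1,2)] reduced_power_map_mem[OF q h(1,3)])+
    then show "\<alpha> H (q H s) = \<alpha> H (q H s') \<longleftrightarrow> (\<forall>\<^sub>F p in \<U>. s p = s' p)"
      by (simp only: reduced_power_map_eq_iff[OF q h])
  next
    fix H K f s assume h: "H \<in> Obj ?C" "K \<in> Obj ?C" "f \<in> Hom ?C H K" "s \<in> sections H \<U>"
    show "farr T' H K f (\<alpha> H (q H s)) = \<alpha> K (q K (\<lambda>p. f (fst p) (s p)))"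
      using nat[OF h(1-3) reduced_power_map_mem[OF q h(1,4)]]
      by (simp only: reduced_power_map_natural[OF q h])
  qed
  then show ?thesis by (rule reduced_powerI)
qed

text \<open>Both functors are quotients of the same sections by the same relation, with the same
  action of maps. So \<open>\<alpha>\<close> may send \<open>t\<close> to the class of any section
  that represents it.\<close>

lemma reduced_power_unique:
  fixes T :: "('x \<Rightarrow> 'u set, 'x \<Rightarrow> 'u \<Rightarrow> 'u, 'v set, 'v \<Rightarrow> 'v) ftr"
    and T' :: "('x \<Rightarrow> 'u set, 'x \<Rightarrow> 'u \<Rightarrow> 'u, 'w set, 'w \<Rightarrow> 'w) ftr"
  assumes T: "reduced_power X \<U> T" and T': "reduced_power X \<U> T'"
  shows "set_iso (fam_cat X) T T'"
proof -
  let ?C = "fam_cat X :: ('x \<Rightarrow> 'u set, 'x \<Rightarrow> 'u \<Rightarrow> 'u) category"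
  obtain q where q: "reduced_power_map X \<U> T q" using T unfolding reduced_power_def ..
  obtain q' where q': "reduced_power_map X \<U> T' q'" using T' unfolding reduced_power_def ..
  define \<alpha> where "\<alpha> H t = q' H (SOME s. s \<in> sections H \<U> \<and> q H s = t)" for H t
  have \<alpha>: "\<alpha> H (q H s) = q' H s" if h: "H \<in> Obj ?C" "s \<in> sections H \<U>" for H s
  proof -
    let ?s = "SOME s'. s' \<in> sections H \<U> \<and> q H s' = q H s"
    have s': "?s \<in> sections H \<U> \<and> q H ?s = q H s" by (rule someI[of _ s]) (simp add: h)
    then have "\<forall>\<^sub>F p in \<U>. ?s p = s p"
      using reduced_power_map_eq_iff[OF q h(1) _ h(2), of ?s] by blast
    then show ?thesis
      unfolding \<alpha>_def using reduced_power_map_eq_iff[OF q' h(1) _ h(2), of ?s] s' by blast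
  qed
  show ?thesis
    unfolding set_iso_def
  proof (intro exI[of _ \<alpha>] conjI ballI)
    fix H assume H: "H \<in> Obj ?C"
    show "bij_betw (\<alpha> H) (fobj T H) (fobj T' H)"
      unfolding reduced_power_map_image[OF q H, symmetric] reduced_power_map_image[OF q' H, symmetric]
        bij_betw_def
    proof
      show "inj_on (\<alpha> H) (q H ` sections H \<U>)"
      proof (rule inj_onI)
        fix t t' assume "t \<in> q H ` sections H \<U>" "t' \<in> q H ` sections H \<U>" and eq: "\<alpha> H t = \<alpha> H t'"
        then obtain s s' where s: "t = q H s" "t' = q H s'" "s \<in> sections H \<U>" "s' \<in> sections H \<U>"
          by blast
        then show "t = t'"
          using eq by (simp add: \<alpha>[OF H] reduced_power_map_eq_iff[OF q H] reduced_power_map_eq_iff[OF q' H])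
      qed
      show "\<alpha> H ` q H ` sections H \<U> = q' H ` sections H \<U>"
        unfolding image_image by (rule image_cong[OF refl \<alpha>[OF H]])
    qed
  next
    fix H K f t assume h: "H \<in> Obj ?C" "K \<in> Obj ?C" "f \<in> Hom ?C H K" and t: "t \<in> fobj T H"
    obtain s where s: "s \<in> sections H \<U>" "t = q H s"
      using t unfolding reduced_power_map_image[OF q h(1), symmetric] by blast
    show "\<alpha> K (farr T H K f t) = farr T' H K f (\<alpha> H t)"
      by (simp add: s(2) reduced_power_map_natural[OF q h s(1)] reduced_power_map_natural[OF q' h s(1)]
          \<alpha>[OF h(1) s(1)] \<alpha>[OF h(2) sections_map[OF s(1) h(3)]])
  qed
qed

text \<open>Precomposition with \<open>j\<close> identifies the germs of sections for the two
  filters: injectivity on a large set lets every section descend along \<open>j\<close>, and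
  preserving the index keeps its values in the right member of \<open>H\<close>.\<close>

lemma reduced_power_filtermap:
  fixes T :: "('x \<Rightarrow> 'u set, 'x \<Rightarrow> 'u \<Rightarrow> 'u, 'v set, 'v \<Rightarrow> 'v) ftr"
  assumes T: "reduced_power X \<U> T" and S: "large \<U> S" and j: "inj_on j S"
    and fst: "\<And>p. p \<in> S \<Longrightarrow> fst (j p) = fst p"
  shows "reduced_power X (filtermap j \<U>) T"
proof -
  let ?C = "fam_cat X :: ('x \<Rightarrow> 'u set, 'x \<Rightarrow> 'u \<Rightarrow> 'u) category"
  obtain q where q: "reduced_power_map X \<U> T q" using T unfolding reduced_power_def ..
  have sec: "s \<in> sections H (filtermap j \<U>) \<longleftrightarrow> (\<lambda>p. s (j p)) \<in> sections H \<U>" for H :: "'x \<Rightarrow> 'u set" and s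
    unfolding sections_def mem_Collect_eq eventually_filtermap
  proof (rule eventually_iff_if)
    show "\<forall>\<^sub>F p in \<U>. (s (j p) \<in> H (fst (j p))) = (s (j p) \<in> H (fst p))"
      using S by eventually_elim (simp add: fst)
  qed
  have "reduced_power_map X (filtermap j \<U>) T (\<lambda>H s. q H (\<lambda>p. s (j p)))"
    unfolding reduced_power_map_def
  proof (intro conjI ballI)
    fix H assume H: "H \<in> Obj ?C"
    show "(\<lambda>s. q H (\<lambda>p. s (j p))) ` sections H (filtermap j \<U>) = fobj T H"
    proof (intro subset_antisym subsetI)
      fix t assume "t \<in> fobj T H"
      then obtain s where s: "s \<in> sections H \<U>" "t = q H s"
        unfolding reduced_power_map_image[OF q H, symmetric] by blast
      \<comment> \<open>The section transported back along \<open>j\<close>; its values outside the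
        image of \<open>S\<close> are junk on a negligible set.\<close>
      let ?s = "\<lambda>r. s (inv_into S j r)"
      have eq: "\<forall>\<^sub>F p in \<U>. ?s (j p) = s p"
        using S by eventually_elim (simp add: inv_into_f_f[OF j])
      have s': "(\<lambda>p. ?s (j p)) \<in> sections H \<U>" by (rule sections_cong[OF s(1) eq])
      show "t \<in> (\<lambda>s. q H (\<lambda>p. s (j p))) ` sections H (filtermap j \<U>)"
      proof (rule image_eqI)
        show "t = q H (\<lambda>p. ?s (j p))"
          using eq reduced_power_map_eq_iff[OF q H s' s(1)] by (simp add: s(2))
        show "?s \<in> sections H (filtermap j \<U>)" unfolding sec by (rule s')
      qed
    next
      fix t assume "t \<in> (\<lambda>s. q H (\<lambda>p. s (j p))) ` sections H (filtermap j \<U>)"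
      then show "t \<in> fobj T H" using reduced_power_map_mem[OF q H] sec by blast
    qed
  next
    fix H s s' assume h: "H \<in> Obj ?C" "s \<in> sections H (filtermap j \<U>)" "s' \<in> sections H (filtermap j \<U>)"
    show "q H (\<lambda>p. s (j p)) = q H (\<lambda>p. s' (j p)) \<longleftrightarrow> (\<forall>\<^sub>F p in filtermap j \<U>. s p = s' p)"
      unfolding eventually_filtermap by (rule reduced_power_map_eq_iff[OF q h(1) h(2,3)[unfolded sec]])
  next
    fix H K f s
    assume h: "H \<in> Obj ?C" "K \<in> Obj ?C" "f \<in> Hom ?C H K" "s \<in> sections H (filtermap j \<U>)"
    note s = h(4)[unfolded sec]
    have f1: "(\<lambda>p. f (fst p) (s (j p))) \<in> sections K \<U>" by (rule sections_map[OF s h(3)])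
    have eq: "\<forall>\<^sub>F p in \<U>. f (fst (j p)) (s (j p)) = f (fst p) (s (j p))"
      using S by eventually_elim (simp add: fst)
    have f2: "(\<lambda>p. f (fst (j p)) (s (j p))) \<in> sections K \<U>" by (rule sections_cong[OF f1 eq])
    show "farr T H K f (q H (\<lambda>p. s (j p))) = q K (\<lambda>p. f (fst (j p)) (s (j p)))"
      using eq reduced_power_map_eq_iff[OF q h(2) f2 f1]
      by (simp add: reduced_power_map_natural[OF q h(1-3) s])
  qed
  then show ?thesis by (rule reduced_powerI)
qed

text \<open>A section \<open>s\<close> goes to the summand indexed by its image ultrafilter
  \<open>im s\<close>, with the class of \<open>s\<close> there. Nothing is lost, since a morphism
  determines the ultrafilter on its target.\<close>

lemma reduced_power_uf_hom:
  fixes A :: "'x \<Rightarrow> 'a set"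
  assumes U: "ultrafilter_on (Sigma X A) \<U>"
  shows "reduced_power X \<U> (uf_integral X (uf_hom_ftr X (A, \<U>)) ::
    ('x \<Rightarrow> 'u set, 'x \<Rightarrow> 'u \<Rightarrow> 'u, (('x \<times> 'u) filter \<times> ('x, 'a, 'u) pmap set) set, _) ftr)"
    (is "reduced_power X \<U> ?T")
proof -
  let ?C = "fam_cat X :: ('x \<Rightarrow> 'u set, 'x \<Rightarrow> 'u \<Rightarrow> 'u) category"
  let ?c = "(A, \<U>)"
  define im where "im s = filtermap (\<lambda>p. (fst p, s p)) \<U>" for s :: "'x \<times> 'a \<Rightarrow> 'u"
  \<comment> \<open>Morphisms must have their domain inside \<open>Sigma X A\<close> and all their
    values in \<open>H\<close>, so \<open>s\<close> is cut down to the points where both hold; these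
    form a large set.\<close>
  define pm where "pm H s p = (if p \<in> Sigma X A \<and> s p \<in> H (fst p) then Some (s p) else None)"
    for H :: "'x \<Rightarrow> 'u set" and s p
  define q where "q H s = (im s, uf_class X ?c (H, im s) (pm H s))" for H s
  have lA: "large \<U> (Sigma X A)" by (rule ultrafilter_on_large[OF U])
  have ev: "\<forall>\<^sub>F p in \<U>. pm H s p = Some (s p)" if "s \<in> sections H \<U>" for H s
  proof -
    have "\<forall>\<^sub>F p in \<U>. s p \<in> H (fst p)" using that by (simp add: sections_def)
    with lA show ?thesis by eventually_elim (simp add: pm_def)
  qed
  have im: "im s \<in> ultras X H" if s: "s \<in> sections H \<U>" for H s
    unfolding im_def ultras_def mem_Collect_eq
  proof (rule ultrafilter_on_filtermap[OF U])
    have "\<forall>\<^sub>F p in \<U>. s p \<in> H (fst p)" using s by (simp add: sections_def)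
    with lA show "\<forall>\<^sub>F p in \<U>. (fst p, s p) \<in> Sigma X H" by eventually_elim auto
  qed
  have pm: "pm H s \<in> uf_maps X ?c (H, im s)" if s: "s \<in> sections H \<U>" for H s
  proof (subst uf_maps_iff)
    show "large (snd (H, im s)) (Sigma X (fst (H, im s)))" using ultras_large[OF im[OF s]] by simp
    have "dom (pm H s) \<subseteq> Sigma X A" by (auto simp: pm_def split: if_splits)
    moreover have "large \<U> (dom (pm H s))"
      using ev[OF s] by eventually_elim (simp add: domI)
    moreover have "im s = filtermap (pmap_fun (pm H s)) \<U>"
      unfolding im_def
    proof (rule filtermap_eventually_cong)
      show "\<forall>\<^sub>F p in \<U>. (fst p, s p) = pmap_fun (pm H s) p"
        using ev[OF s] by eventually_elim (simp add: pmap_fun_def)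
    qed
    ultimately show "dom (pm H s) \<subseteq> Sigma X (fst ?c) \<and> large (snd ?c) (dom (pm H s)) \<and>
      (\<forall>x a b. pm H s (x, a) = Some b \<longrightarrow> b \<in> fst (H, im s) x) \<and>
      snd (H, im s) = filtermap (pmap_fun (pm H s)) (snd ?c)"
      by (auto simp: pm_def split: if_splits)
  qed
  have "reduced_power_map X \<U> ?T q"
    unfolding reduced_power_map_def
  proof (intro conjI ballI)
    fix H assume H: "H \<in> Obj ?C"
    show "q H ` sections H \<U> = fobj ?T H"
    proof (intro subset_antisym subsetI)
      fix t assume "t \<in> fobj ?T H"
      then obtain \<W> f where W: "\<W> \<in> ultras X H" and f: "f \<in> uf_maps X ?c (H, \<W>)"
        and t: "t = (\<W>, uf_class X ?c (H, \<W>) f)"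
        by (auto simp: fobj_uf_integral uf_hom_ftr_def elim: uf_hom_cases)
      have lW: "large (snd (H, \<W>)) (Sigma X (fst (H, \<W>)))" using ultras_large[OF W] by simp
      have f': "large \<U> (dom f)" "\<And>x a b. f (x, a) = Some b \<Longrightarrow> b \<in> H x" "\<W> = filtermap (pmap_fun f) \<U>"
        using f by (simp_all add: uf_maps_iff[OF lW])
      let ?s = "\<lambda>p. the (f p)"
      have "\<forall>\<^sub>F p in \<U>. ?s p \<in> H (fst p)"
        using f'(1)
      proof eventually_elim
        fix p assume "p \<in> dom f"
        then obtain b where "f p = Some b" by (auto dest: domD)
        then show "?s p \<in> H (fst p)" using f'(2)[of "fst p" "snd p"] by simp
      qed
      then have s: "?s \<in> sections H \<U>" by (simp add: sections_def)
      have W': "im ?s = \<W>" unfolding im_def f'(3) by (simp add: pmap_fun_def[abs_def])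
      have "\<forall>\<^sub>F p in \<U>. f p = pm H ?s p"
        using f'(1) ev[OF s] by eventually_elim auto
      then have "uf_class X ?c (H, \<W>) f = uf_class X ?c (H, \<W>) (pm H ?s)"
        using uf_class_eq[OF f pm[OF s, unfolded W']] by simp
      then show "t \<in> q H ` sections H \<U>"
        using s by (intro image_eqI[of _ _ ?s]) (simp_all add: t q_def W')
    next
      fix t assume "t \<in> q H ` sections H \<U>"
      then obtain s where s: "s \<in> sections H \<U>" "t = q H s" by blast
      then show "t \<in> fobj ?T H"
        by (simp add: q_def fobj_uf_integral uf_hom_ftr_def im uf_class_in_hom[OF pm])
    qed
  next
    fix H s s' assume h: "H \<in> Obj ?C" "s \<in> sections H \<U>" "s' \<in> sections H \<U>"
    \<comment> \<open>Equal germs lie in the same summand; within one summand their classes can be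
      compared.\<close>
    have 1: "im s = im s'" if "\<forall>\<^sub>F p in \<U>. s p = s' p"
      unfolding im_def by (rule filtermap_eventually_cong) (use that in \<open>eventually_elim, simp\<close>)
    have 2: "uf_class X ?c (H, im s) (pm H s) = uf_class X ?c (H, im s) (pm H s') \<longleftrightarrow>
      (\<forall>\<^sub>F p in \<U>. s p = s' p)" if i: "im s = im s'"
    proof -
      have "(\<forall>\<^sub>F p in \<U>. pm H s p = pm H s' p) \<longleftrightarrow> (\<forall>\<^sub>F p in \<U>. s p = s' p)"
        by (rule eventually_iff_if) (use ev[OF h(2)] ev[OF h(3)] in \<open>eventually_elim, simp\<close>)
      then show ?thesis
        using uf_class_eq[OF pm[OF h(2)] pm[OF h(3), folded i]] by simp
    qed
    show "q H s = q H s' \<longleftrightarrow> (\<forall>\<^sub>F p in \<U>. s p = s' p)"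
    proof (cases "im s = im s'")
      case True
      then show ?thesis using 2[OF True] by (simp add: q_def)
    next
      case False
      then have "\<not> (\<forall>\<^sub>F p in \<U>. s p = s' p)" using 1 by blast
      with False show ?thesis by (simp add: q_def)
    qed
  next
    fix H K f s assume h: "H \<in> Obj ?C" "K \<in> Obj ?C" "f \<in> Hom ?C H K" "s \<in> sections H \<U>"
    let ?fs = "\<lambda>p. f (fst p) (s p)"
    have fs: "?fs \<in> sections K \<U>" by (rule sections_map[OF h(4,3)])
    have pu: "push f (im s) = im ?fs"
      by (simp add: push_eq im_def filtermap_filtermap)
    have sH: "\<forall>\<^sub>F p in \<U>. s p \<in> H (fst p)" using h(4) by (simp add: sections_def)
    have m: "total_pmap X H f \<in> uf_maps X (H, im s) (K, im ?fs)"
      using total_pmap_maps[OF h(3) im[OF h(4)]] by (simp only: pu)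
    have l: "large (snd (H, im s)) (Sigma X (fst (H, im s)))"
      "large (snd (K, im ?fs)) (Sigma X (fst (K, im ?fs)))"
      using ultras_large[OF im[OF h(4)]] ultras_large[OF im[OF fs]] by simp_all
    have "\<forall>\<^sub>F p in \<U>. pmap_comp (total_pmap X H f) (pm H s) p = pm K ?fs p"
      using ev[OF h(4)] ev[OF fs] lA sH
      by eventually_elim (auto simp: pmap_comp_apply total_pmap_apply)
    then have "uf_class X ?c (K, im ?fs) (pmap_comp (total_pmap X H f) (pm H s)) =
        uf_class X ?c (K, im ?fs) (pm K ?fs)"
      using uf_class_eq[OF pmap_comp_maps[OF pm[OF h(4)] m l] pm[OF fs]] by simp
    moreover have "uf_class X ?c (H, im s) (pm H s) \<in> fobj (uf_hom_ftr X ?c) (H, im s)"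
      by (simp add: uf_hom_ftr_def uf_class_in_hom[OF pm[OF h(4)]])
    ultimately show "farr ?T H K f (q H s) = q K ?fs"
      by (simp add: q_def farr_uf_integral[OF im[OF h(4)]] pu uf_hom_ftr_def
          uf_comp_class[OF pm[OF h(4)] m l])
  qed
  then show ?thesis by (rule reduced_powerI)
qed

section \<open>Reduced powers of reduced powers\<close>

lemma eventually_mat_ultra_comp:
  "eventually P (mat_ultra_comp \<V> \<U> z) \<longleftrightarrow>
   (\<forall>\<^sub>F p in \<V> z. \<forall>\<^sub>F r in \<U> (fst p). P (fst r, (fst p, snd p, snd r)))"
  by (simp add: mat_ultra_comp_def eventually_filtermap eventually_ultra_sum case_prod_beta')

text \<open>An element of \<open>T'\<close> at \<open>T H\<close> is a germ over
  \<open>\<V> z\<close> of a function whose value at \<open>(y, n)\<close> is a germ over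
  \<open>\<U> y\<close>. Uncurrying turns this into a germ over the indexed sum, because a property
  holds almost everywhere there iff it holds for almost all \<open>r\<close> for almost all
  \<open>p\<close>.\<close>

lemma reduced_power_ftr_comp:
  fixes T :: "('x \<Rightarrow> 'u set, 'x \<Rightarrow> 'u \<Rightarrow> 'u, 'y \<Rightarrow> 'u set, 'y \<Rightarrow> 'u \<Rightarrow> 'u) ftr"
    and T' :: "('y \<Rightarrow> 'u set, 'y \<Rightarrow> 'u \<Rightarrow> 'u, 'v set, 'v \<Rightarrow> 'v) ftr"
    and \<U> :: "'y \<Rightarrow> ('x \<times> 'm) filter" and \<V> :: "'z \<Rightarrow> ('y \<times> 'n) filter"
  assumes T: "is_functor (fam_cat X) (fam_cat Y) T"
    and Ty: "\<And>y. y \<in> Y \<Longrightarrow> reduced_power X (\<U> y) (at_index T y)"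
    and T': "reduced_power Y (\<V> z) T'" and V: "\<forall>\<^sub>F p in \<V> z. fst p \<in> Y"
  shows "reduced_power X (mat_ultra_comp \<V> \<U> z) (ftr_comp T' T)"
proof -
  let ?C = "fam_cat X :: ('x \<Rightarrow> 'u set, 'x \<Rightarrow> 'u \<Rightarrow> 'u) category"
  let ?W = "mat_ultra_comp \<V> \<U> z"
  obtain q' where q': "reduced_power_map Y (\<V> z) T' q'" using T' unfolding reduced_power_def ..
  define Q where "Q y = (SOME q. reduced_power_map X (\<U> y) (at_index T y) q)" for y
  have Q: "reduced_power_map X (\<U> y) (at_index T y) (Q y)" if "y \<in> Y" for y
    unfolding Q_def by (rule someI_ex[OF Ty[OF that, unfolded reduced_power_def]])
  \<comment> \<open>The slice of a section at \<open>p = (y, n)\<close>. It depends on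
    \<open>n\<close>, although the ultrafilter \<open>\<U> y\<close> over which it is taken does
    not; only almost every slice need be a section.\<close>
  define sl where "sl s p r = s (fst r, (fst p, snd p, snd r))"
    for s :: "'x \<times> 'y \<times> 'n \<times> 'm \<Rightarrow> 'u" and p :: "'y \<times> 'n" and r :: "'x \<times> 'm"
  define \<sigma> where "\<sigma> H s p = Q (fst p) H (sl s p)" for H s p
  have TO: "fobj T H \<in> Obj (fam_cat Y)" if "H \<in> Obj ?C" for H
    by (rule is_functor_fobj[OF T that])
  have sl: "\<forall>\<^sub>F p in \<V> z. fst p \<in> Y \<and> sl s p \<in> sections H (\<U> (fst p))" if "s \<in> sections H ?W" for H s
  proof -
    have "\<forall>\<^sub>F p in \<V> z. \<forall>\<^sub>F r in \<U> (fst p). sl s p r \<in> H (fst r)"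
      using that by (simp add: sections_def eventually_mat_ultra_comp sl_def)
    with V show ?thesis by eventually_elim (simp add: sections_def)
  qed
  have QT: "Q y H s \<in> fobj T H y" if "y \<in> Y" "H \<in> Obj ?C" "s \<in> sections H (\<U> y)" for y H s
    using reduced_power_map_mem[OF Q[OF that(1)] that(2,3)] by (simp add: at_index_def)
  have \<sigma>: "\<sigma> H s \<in> sections (fobj T H) (\<V> z)" if H: "H \<in> Obj ?C" and s: "s \<in> sections H ?W" for H s
  proof -
    have "\<forall>\<^sub>F p in \<V> z. \<sigma> H s p \<in> fobj T H (fst p)"
      using sl[OF s] by eventually_elim (simp add: \<sigma>_def QT[OF _ H])
    then show ?thesis by (simp add: sections_def)
  qed
  have "reduced_power_map X ?W (ftr_comp T' T) (\<lambda>H s. q' (fobj T H) (\<sigma> H s))"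
    unfolding reduced_power_map_def
  proof (intro conjI ballI)
    fix H assume H: "H \<in> Obj ?C"
    show "(\<lambda>s. q' (fobj T H) (\<sigma> H s)) ` sections H ?W = fobj (ftr_comp T' T) H"
    proof (intro subset_antisym subsetI)
      fix t assume "t \<in> fobj (ftr_comp T' T) H"
      then have "t \<in> fobj T' (fobj T H)" by (simp add: ftr_comp_def)
      then obtain \<tau> where \<tau>: "\<tau> \<in> sections (fobj T H) (\<V> z)" "t = q' (fobj T H) \<tau>"
        unfolding reduced_power_map_image[OF q' TO[OF H], symmetric] by blast
      \<comment> \<open>A choice of representing section at every \<open>p\<close> simultaneously,
        with junk at the negligibly many \<open>p\<close> where there is none; gluing these gives
        the preimage \<open>s\<close>.\<close>
      define c where "c p = (SOME u. u \<in> sections H (\<U> (fst p)) \<and> Q (fst p) H u = \<tau> p)" for p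
      define s where "s w = (case w of (x, y, n, m) \<Rightarrow> c (y, n) (x, m))" for w
      have sl_s: "sl s p = c p" for p by (rule ext) (simp add: sl_def s_def)
      have "\<forall>\<^sub>F p in \<V> z. \<tau> p \<in> fobj T H (fst p)" using \<tau>(1) by (simp add: sections_def)
      with V have c: "\<forall>\<^sub>F p in \<V> z. c p \<in> sections H (\<U> (fst p)) \<and> Q (fst p) H (c p) = \<tau> p"
      proof eventually_elim
        fix p assume p: "fst p \<in> Y" and "\<tau> p \<in> fobj T H (fst p)"
        then have "\<tau> p \<in> Q (fst p) H ` sections H (\<U> (fst p))"
          by (simp add: reduced_power_map_image[OF Q[OF p] H] at_index_def)
        then obtain u where "\<tau> p = Q (fst p) H u" "u \<in> sections H (\<U> (fst p))" by (rule imageE)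
        then have "\<exists>u. u \<in> sections H (\<U> (fst p)) \<and> Q (fst p) H u = \<tau> p"
          by (intro exI[of _ u]) simp
        then show "c p \<in> sections H (\<U> (fst p)) \<and> Q (fst p) H (c p) = \<tau> p"
          unfolding c_def by (rule someI_ex)
      qed
      have "\<forall>\<^sub>F p in \<V> z. \<forall>\<^sub>F r in \<U> (fst p). sl s p r \<in> H (fst r)"
        using c by eventually_elim (simp add: sl_s sections_def)
      then have s: "s \<in> sections H ?W"
        by (simp add: sections_def eventually_mat_ultra_comp sl_def)
      have "\<forall>\<^sub>F p in \<V> z. \<sigma> H s p = \<tau> p"
        using c by eventually_elim (simp add: \<sigma>_def sl_s)
      then have "t = q' (fobj T H) (\<sigma> H s)"
        using reduced_power_map_eq_iff[OF q' TO[OF H] \<sigma>[OF H s] \<tau>(1)] by (simp add: \<tau>(2))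
      then show "t \<in> (\<lambda>s. q' (fobj T H) (\<sigma> H s)) ` sections H ?W" using s by (rule image_eqI)
    next
      fix t assume "t \<in> (\<lambda>s. q' (fobj T H) (\<sigma> H s)) ` sections H ?W"
      then show "t \<in> fobj (ftr_comp T' T) H"
        by (auto simp: ftr_comp_def intro: reduced_power_map_mem[OF q' TO[OF H] \<sigma>[OF H]])
    qed
  next
    fix H s s' assume h: "H \<in> Obj ?C" "s \<in> sections H ?W" "s' \<in> sections H ?W"
    have "(\<forall>\<^sub>F p in \<V> z. \<sigma> H s p = \<sigma> H s' p) \<longleftrightarrow> (\<forall>\<^sub>F p in \<V> z. \<forall>\<^sub>F r in \<U> (fst p). sl s p r = sl s' p r)"
    proof (rule eventually_iff_if)
      show "\<forall>\<^sub>F p in \<V> z. \<sigma> H s p = \<sigma> H s' p \<longleftrightarrow> (\<forall>\<^sub>F r in \<U> (fst p). sl s p r = sl s' p r)"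
        using sl[OF h(2)] sl[OF h(3)]
        by eventually_elim (simp add: \<sigma>_def reduced_power_map_eq_iff[OF Q h(1)])
    qed
    then show "q' (fobj T H) (\<sigma> H s) = q' (fobj T H) (\<sigma> H s') \<longleftrightarrow> (\<forall>\<^sub>F p in ?W. s p = s' p)"
      by (simp add: reduced_power_map_eq_iff[OF q' TO[OF h(1)] \<sigma>[OF h(1,2)] \<sigma>[OF h(1,3)]]
          eventually_mat_ultra_comp sl_def)
  next
    fix H K f s assume h: "H \<in> Obj ?C" "K \<in> Obj ?C" "f \<in> Hom ?C H K" "s \<in> sections H ?W"
    let ?fs = "\<lambda>p. f (fst p) (s p)"
    have fs: "?fs \<in> sections K ?W" by (rule sections_map[OF h(4,3)])
    have Tf: "farr T H K f \<in> Hom (fam_cat Y) (fobj T H) (fobj T K)"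
      by (rule is_functor_farr[OF T h(1-3)])
    have "\<forall>\<^sub>F p in \<V> z. farr T H K f (fst p) (\<sigma> H s p) = \<sigma> K ?fs p"
      using sl[OF h(4)]
    proof eventually_elim
      fix p assume p: "fst p \<in> Y \<and> sl s p \<in> sections H (\<U> (fst p))"
      have "(\<lambda>r. f (fst r) (sl s p r)) = sl ?fs p" by (rule ext) (simp add: sl_def)
      then show "farr T H K f (fst p) (\<sigma> H s p) = \<sigma> K ?fs p"
        using reduced_power_map_natural[OF Q h(1-3), of "fst p" "sl s p"] p
        by (simp add: at_index_def \<sigma>_def)
    qed
    then have "q' (fobj T K) (\<lambda>p. farr T H K f (fst p) (\<sigma> H s p)) = q' (fobj T K) (\<sigma> K ?fs)"
      using reduced_power_map_eq_iff[OF q' TO[OF h(2)] sections_map[OF \<sigma>[OF h(1,4)] Tf] \<sigma>[OF h(2) fs]]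
      by simp
    then show "farr (ftr_comp T' T) H K f (q' (fobj T H) (\<sigma> H s)) = q' (fobj T K) (\<sigma> K ?fs)"
      using reduced_power_map_natural[OF q' TO[OF h(1)] TO[OF h(2)] Tf \<sigma>[OF h(1,4)]]
      by (simp add: ftr_comp_def)
  qed
  then show ?thesis by (rule reduced_powerI)
qed


section \<open>Composites of representable one-cells\<close>

lemma ultramatrix_comp:
  fixes M :: "'x \<Rightarrow> 'y \<Rightarrow> 'm set" and N :: "'y \<Rightarrow> 'z \<Rightarrow> 'n set"
  assumes u: "set_universe TYPE('u)" and Y: "small TYPE('u) Y"
    and M: "ultramatrix TYPE('u) X Y M \<U>" and N: "ultramatrix TYPE('u) Y Z N \<V>"
  shows "ultramatrix TYPE('u) X Z (mat_comp Y N M) (mat_ultra_comp \<V> \<U>)"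
proof -
  have sM: "\<And>x y. x \<in> X \<Longrightarrow> y \<in> Y \<Longrightarrow> small TYPE('u) (M x y)"
    and sN: "\<And>y z. y \<in> Y \<Longrightarrow> z \<in> Z \<Longrightarrow> small TYPE('u) (N y z)"
    and uM: "\<And>y. y \<in> Y \<Longrightarrow> ultrafilter_on (SIGMA x:X. M x y) (\<U> y)"
    and uN: "\<And>z. z \<in> Z \<Longrightarrow> ultrafilter_on (SIGMA y:Y. N y z) (\<V> z)"
    using M N by (simp_all add: ultramatrix_def)
  have "small TYPE('u) (mat_comp Y N M x z)" if "x \<in> X" "z \<in> Z" for x z
    unfolding mat_comp_def using that
    by (intro small_Sigma[OF u Y] small_Sigma[OF u] sM sN)
  moreover have "ultrafilter_on (SIGMA x:X. mat_comp Y N M x z) (mat_ultra_comp \<V> \<U> z)"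
    if z: "z \<in> Z" for z
    unfolding mat_ultra_comp_def
  proof (rule ultrafilter_on_filtermap)
    let ?S = "SIGMA p:(SIGMA y:Y. N y z). SIGMA x:X. M x (fst p)"
    show uS: "ultrafilter_on ?S (ultra_sum (\<V> z) (\<lambda>(y, n). \<U> y))"
      by (rule ultrafilter_on_ultra_sum[OF uN[OF z]]) (auto simp: uM)
    show "\<forall>\<^sub>F p in ultra_sum (\<V> z) (\<lambda>(y, n). \<U> y).
        (case p of (p', r) \<Rightarrow> (case p' of (y, n) \<Rightarrow> \<lambda>(x, m). (x, y, n, m)) r)
        \<in> (SIGMA x:X. mat_comp Y N M x z)"
      using ultrafilter_on_large[OF uS] by eventually_elim (auto simp: mat_comp_def)
  qed
  ultimately show ?thesis by (simp add: ultramatrix_def)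
qed

text \<open>Passes from representability to a condition on the integral, where composition is
  defined. The isomorphism is inverted because reduced powers are transported forward along
  isomorphisms.\<close>

lemma reduced_power_if_represented:
  fixes F :: "('x, 'y, 'u) uesp"
  assumes F: "ultramatrix_represents X Y M \<U> F" and y: "y \<in> Y"
  shows "reduced_power X (\<U> y) (at_index (integral X F) y)"
proof -
  have U: "ultrafilter_on (SIGMA x:X. M x y) (\<U> y)"
    and iso: "set_iso (uf_cat X) (at_index F y) (uf_hom_ftr X (\<lambda>x. M x y, \<U> y))"
    and one: "one_cell X Y F"
    using F y by (simp_all add: ultramatrix_represents_def ultramatrix_def)
  have "set_functor (uf_cat X) (at_index F y)"
    by (rule set_functor_at_index[OF one[unfolded one_cell_def]])
  from set_iso_uf_integral[OF set_iso_sym[OF this iso]] show ?thesis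
    unfolding at_index_integral by (rule reduced_power_set_iso[OF reduced_power_uf_hom[OF U]])
qed

text \<open>The way back: two reduced powers modulo the same ultrafilter are isomorphic integrals,
  and the integral reflects isomorphism. Any family on which the ultrafilter lives gives a
  representing pair.\<close>

lemma represented_if_reduced_power:
  fixes K :: "('x, 'z, 'u) uesp"
  assumes K: "one_cell X Z K" and U: "ultrafilter_on (Sigma X A) \<U>"
    and red: "reduced_power X \<U> (at_index (integral X K) z)"
  shows "set_iso (uf_cat X) (at_index K z) (uf_hom_ftr X (A, \<U>))"
proof (rule set_iso_if_set_iso_uf_integral)
  show "set_functor (uf_cat X) (at_index K z)"
    by (rule set_functor_at_index[OF K[unfolded one_cell_def]])
  show "set_functor (uf_cat X) (uf_hom_ftr X (A, \<U>))" by (rule set_functor_uf_hom_ftr)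
  show "set_iso (fam_cat X) (uf_integral X (at_index K z)) (uf_integral X (uf_hom_ftr X (A, \<U>)))"
    using red unfolding at_index_integral by (rule reduced_power_unique[OF _ reduced_power_uf_hom[OF U]])
qed

text \<open>Stated for the intermediate functor \<open>T\<close>, so that it serves both for
  analysing a given composite and for constructing one.\<close>

lemma reduced_power_integral_comp:
  fixes F :: "('x, 'y, 'u) uesp" and G :: "('y, 'z, 'u) uesp"
  assumes F: "ultramatrix_represents X Y M \<U> F" and G: "ultramatrix_represents Y Z N \<V> G"
    and T: "is_functor (fam_cat X) (fam_cat Y) T" "fam_iso (fam_cat X) Y T (integral X F)"
    and z: "z \<in> Z"
  shows "reduced_power X (mat_ultra_comp \<V> \<U> z) (at_index (ftr_comp (integral Y G) T) z)"
proof -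
  have "at_index (ftr_comp (integral Y G) T) z = ftr_comp (at_index (integral Y G) z) T"
    by (simp add: at_index_def ftr_comp_def)
  moreover have "reduced_power X (mat_ultra_comp \<V> \<U> z) (ftr_comp (at_index (integral Y G) z) T)"
  proof (rule reduced_power_ftr_comp[OF T(1)])
    fix y assume y: "y \<in> Y"
    have "set_iso (fam_cat X) (at_index T y) (at_index (integral X F) y)"
      using T(2) y by (simp add: fam_iso_def)
    then show "reduced_power X (\<U> y) (at_index T y)"
      using reduced_power_set_iso[OF reduced_power_if_represented[OF F y]]
        set_iso_sym[OF set_functor_at_index[OF T(1)]] by blast
  next
    show "reduced_power Y (\<V> z) (at_index (integral Y G) z)"
      by (rule reduced_power_if_represented[OF G z])
    have "large (\<V> z) (SIGMA y:Y. N y z)"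
      using G z by (simp add: ultramatrix_represents_def ultramatrix_def ultrafilter_on_large)
    then show "\<forall>\<^sub>F p in \<V> z. fst p \<in> Y" by eventually_elim auto
  qed
  ultimately show ?thesis by simp
qed

lemma reduced_power_composite:
  fixes F :: "('x, 'y, 'u) uesp" and G :: "('y, 'z, 'u) uesp" and K :: "('x, 'z, 'u) uesp"
  assumes F: "ultramatrix_represents X Y M \<U> F" and G: "ultramatrix_represents Y Z N \<V> G"
    and K: "is_composite X Y Z G F K" and z: "z \<in> Z"
  shows "reduced_power X (mat_ultra_comp \<V> \<U> z) (at_index (integral X K) z)"
proof -
  obtain T where T: "is_functor (fam_cat X) (fam_cat Y) T" "fam_iso (fam_cat X) Y T (integral X F)"
    and iso: "fam_iso (fam_cat X) Z (integral X K) (ftr_comp (integral Y G) T)" and one: "one_cell X Z K"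
    using K by (auto simp: is_composite_def)
  have "set_functor (fam_cat X) (at_index (integral X K) z)"
    unfolding at_index_integral
    by (rule set_functor_uf_integral[OF set_functor_at_index[OF one[unfolded one_cell_def]]])
  moreover have "set_iso (fam_cat X) (at_index (integral X K) z) (at_index (ftr_comp (integral Y G) T) z)"
    using iso z by (simp add: fam_iso_def)
  ultimately have "set_iso (fam_cat X) (at_index (ftr_comp (integral Y G) T) z) (at_index (integral X K) z)"
    by (rule set_iso_sym)
  with reduced_power_integral_comp[OF F G T z] show ?thesis by (rule reduced_power_set_iso)
qed

lemma ultramatrix_represents_composite:
  fixes F :: "('x, 'y, 'u) uesp" and G :: "('y, 'z, 'u) uesp" and K :: "('x, 'z, 'u) uesp"
  assumes u: "set_universe TYPE('u)" and Y: "small TYPE('u) Y"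
    and F: "ultramatrix_represents X Y M \<U> F" and G: "ultramatrix_represents Y Z N \<V> G"
    and K: "is_composite X Y Z G F K"
  shows "ultramatrix_represents X Z (mat_comp Y N M) (mat_ultra_comp \<V> \<U>) K"
proof -
  have one: "one_cell X Z K" using K by (simp add: is_composite_def)
  have NM: "ultramatrix TYPE('u) X Z (mat_comp Y N M) (mat_ultra_comp \<V> \<U>)"
    using F G by (intro ultramatrix_comp[OF u Y]) (simp_all add: ultramatrix_represents_def)
  have "set_iso (uf_cat X) (at_index K z) (uf_hom_ftr X (\<lambda>x. mat_comp Y N M x z, mat_ultra_comp \<V> \<U> z))"
    if z: "z \<in> Z" for z
    using NM z reduced_power_composite[OF F G K z]
    by (intro represented_if_reduced_power[OF one]) (simp_all add: ultramatrix_def)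
  with NM one show ?thesis by (simp add: ultramatrix_represents_def)
qed

text \<open>The composite matrix has the additional coordinate \<open>y\<close>, which equals
  \<open>h n\<close> almost everywhere; forgetting it and swapping \<open>n\<close> and
  \<open>m\<close> gives the filter of the composite span.\<close>

lemma span_mat_ultra_comp:
  "span_mat_ultra (f \<circ> fst) (span_ultra_comp h \<V> \<U>) z =
   filtermap (\<lambda>(x, y, n, m). (x, (m, n))) (mat_ultra_comp (span_mat_ultra h \<V>) (span_mat_ultra f \<U>) z)"
  unfolding filter_eq_iff
  by (simp add: eventually_filtermap eventually_mat_ultra_comp span_mat_ultra_def span_ultra_comp_def
      eventually_ultra_sum)

lemma ultraspan_comp:
  fixes f :: "'a \<Rightarrow> 'x" and g :: "'a \<Rightarrow> 'y" and h :: "'b \<Rightarrow> 'y" and k :: "'b \<Rightarrow> 'z"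
  assumes u: "set_universe TYPE('u)"
    and M: "ultraspan TYPE('u) X Y M f g \<U>" and N: "ultraspan TYPE('u) Y Z N h k \<V>"
  shows "ultraspan TYPE('u) X Z (span_apex M N g h) (f \<circ> fst) (k \<circ> snd) (span_ultra_comp h \<V> \<U>)"
proof -
  have sM: "small TYPE('u) M" and f: "f \<in> M \<rightarrow> X"
    and U: "\<And>y. y \<in> Y \<Longrightarrow> ultrafilter_on {m \<in> M. g m = y} (\<U> y)"
    and sN: "small TYPE('u) N" and h: "h \<in> N \<rightarrow> Y" and k: "k \<in> N \<rightarrow> Z"
    and V: "\<And>z. z \<in> Z \<Longrightarrow> ultrafilter_on {n \<in> N. k n = z} (\<V> z)"
    using M N by (simp_all add: ultraspan_def ultrafamily_def)
  have "small TYPE('u) (span_apex M N g h)"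
    by (rule small_mono[OF small_Sigma[OF u sM sN]]) (auto simp: span_apex_def)
  moreover have "f \<circ> fst \<in> span_apex M N g h \<rightarrow> X" "k \<circ> snd \<in> span_apex M N g h \<rightarrow> Z"
    using f k by (auto simp: span_apex_def)
  moreover have "ultrafilter_on {p \<in> span_apex M N g h. (k \<circ> snd) p = z} (span_ultra_comp h \<V> \<U> z)"
    if z: "z \<in> Z" for z
    unfolding span_ultra_comp_def
  proof (rule ultrafilter_on_filtermap)
    \<comment> \<open>The sum of the fibres of \<open>snd\<close> over the fibre of \<open>k\<close>
      at \<open>z\<close>; its second projection lands in the fibre of
      \<open>k \<circ> snd\<close>.\<close>
    let ?S = "SIGMA n:{n \<in> N. k n = z}. {p \<in> span_apex M N g h. snd p = n}"
    show uS: "ultrafilter_on ?S (ultra_sum (\<V> z) (\<lambda>n. filtermap (\<lambda>m. (m, n)) (\<U> (h n))))"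
    proof (rule ultrafilter_on_ultra_sum[OF V[OF z]])
      fix n assume n: "n \<in> {n \<in> N. k n = z}"
      then have hn: "h n \<in> Y" using h by auto
      show "ultrafilter_on {p \<in> span_apex M N g h. snd p = n} (filtermap (\<lambda>m. (m, n)) (\<U> (h n)))"
      proof (rule ultrafilter_on_filtermap[OF U[OF hn]])
        show "\<forall>\<^sub>F m in \<U> (h n). (m, n) \<in> {p \<in> span_apex M N g h. snd p = n}"
          using ultrafilter_on_large[OF U[OF hn]] by eventually_elim (use n in \<open>simp add: span_apex_def\<close>)
      qed
    qed
    show "\<forall>\<^sub>F p in ultra_sum (\<V> z) (\<lambda>n. filtermap (\<lambda>m. (m, n)) (\<U> (h n))).
        snd p \<in> {p \<in> span_apex M N g h. (k \<circ> snd) p = z}"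
      using ultrafilter_on_large[OF uS] by eventually_elim auto
  qed
  ultimately show ?thesis by (simp add: ultraspan_def ultrafamily_def)
qed

lemma ultramatrix_of_ultraspan:
  assumes M: "ultraspan u X Y M f g \<U>"
  shows "ultramatrix u X Y (span_mat M f g) (span_mat_ultra f \<U>)"
proof -
  have sM: "small u M" and f: "f \<in> M \<rightarrow> X"
    and U: "\<And>y. y \<in> Y \<Longrightarrow> ultrafilter_on {m \<in> M. g m = y} (\<U> y)"
    using M by (simp_all add: ultraspan_def ultrafamily_def)
  have "small u (span_mat M f g x y)" for x y
    by (rule small_mono[OF sM]) (auto simp: span_mat_def)
  moreover have "ultrafilter_on (SIGMA x:X. span_mat M f g x y) (span_mat_ultra f \<U> y)" if y: "y \<in> Y" for y
    unfolding span_mat_ultra_def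
  proof (rule ultrafilter_on_filtermap[OF U[OF y]])
    show "\<forall>\<^sub>F m in \<U> y. (f m, m) \<in> (SIGMA x:X. span_mat M f g x y)"
      using ultrafilter_on_large[OF U[OF y]]
      by eventually_elim (use f in \<open>auto simp: span_mat_def\<close>)
  qed
  ultimately show ?thesis by (simp add: ultramatrix_def)
qed

text \<open>The ultramatrix of the composite span and the composite of the two ultramatrices have
  different entries, so they are compared through their reduced powers by relabelling.\<close>

lemma ultraspan_represents_composite:
  fixes F :: "('x, 'y, 'u) uesp" and G :: "('y, 'z, 'u) uesp" and K :: "('x, 'z, 'u) uesp"
    and M :: "'a set" and N :: "'b set"
  assumes u: "set_universe TYPE('u)"
    and F: "ultraspan_represents X Y M f g \<U> F" and G: "ultraspan_represents Y Z N h k \<V> G"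
    and K: "is_composite X Y Z G F K"
  shows "ultraspan_represents X Z (span_apex M N g h) (f \<circ> fst) (k \<circ> snd) (span_ultra_comp h \<V> \<U>) K"
proof -
  have one: "one_cell X Z K" using K by (simp add: is_composite_def)
  have F': "ultramatrix_represents X Y (span_mat M f g) (span_mat_ultra f \<U>) F"
    and G': "ultramatrix_represents Y Z (span_mat N h k) (span_mat_ultra h \<V>) G"
    and M: "ultraspan TYPE('u) X Y M f g \<U>" and N: "ultraspan TYPE('u) Y Z N h k \<V>"
    using F G by (simp_all add: ultraspan_represents_def)
  note span = ultraspan_comp[OF u M N]
  note mat = ultramatrix_of_ultraspan[OF span]
  let ?j = "\<lambda>(x, y, n, m). (x, (m, n)) :: 'x \<times> 'a \<times> 'b"
  \<comment> \<open>The relabelling \<open>?j\<close> forgets \<open>y\<close>, so it is injective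
    only where \<open>y\<close> is determined as \<open>h n\<close>. This set is large because the
    ultrafilters of the second matrix are images under the map sending \<open>n\<close> to
    \<open>(h n, n)\<close>.\<close>
  let ?S = "{w :: 'x \<times> 'y \<times> 'b \<times> 'a. fst (snd w) = h (fst (snd (snd w)))}"
  have "reduced_power X (span_mat_ultra (f \<circ> fst) (span_ultra_comp h \<V> \<U>) z) (at_index (integral X K) z)"
    if z: "z \<in> Z" for z
    unfolding span_mat_ultra_comp
  proof (rule reduced_power_filtermap[OF reduced_power_composite[OF F' G' K z]])
    show "large (mat_ultra_comp (span_mat_ultra h \<V>) (span_mat_ultra f \<U>) z) ?S"
      by (simp add: eventually_mat_ultra_comp span_mat_ultra_def eventually_filtermap)
    show "inj_on ?j ?S" by (auto simp: inj_on_def)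
    show "fst (?j p) = fst p" for p by (simp add: case_prod_beta')
  qed
  then have "set_iso (uf_cat X) (at_index K z) (uf_hom_ftr X
      (\<lambda>x. span_mat (span_apex M N g h) (f \<circ> fst) (k \<circ> snd) x z,
       span_mat_ultra (f \<circ> fst) (span_ultra_comp h \<V> \<U>) z))" if "z \<in> Z" for z
    using mat that by (intro represented_if_reduced_power[OF one]) (simp_all add: ultramatrix_def)
  with span mat one show ?thesis
    by (simp add: ultraspan_represents_def ultramatrix_represents_def)
qed

section \<open>Representing objects over the universe and existence of composites\<close>

lemma pointwise_representable_imp_ultramatrix:
  fixes F :: "('x, 'y, 'u) uesp"
  assumes "pointwise_representable X Y F"
  shows "\<exists>(M :: 'x \<Rightarrow> 'y \<Rightarrow> 'u set) \<U>. ultramatrix_represents X Y M \<U> F"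
proof -
  have one: "one_cell X Y F"
    and ex: "\<forall>y\<in>Y. \<exists>c :: ('x, 'u) ufobj. c \<in> Obj (uf_cat X) \<and>
      set_iso (uf_cat X) (at_index F y) (uf_hom_ftr X c)"
    using assms by (simp_all add: pointwise_representable_def)
  from bchoice[OF ex] obtain c :: "'y \<Rightarrow> ('x, 'u) ufobj" where c: "\<forall>y\<in>Y. c y \<in> Obj (uf_cat X) \<and>
      set_iso (uf_cat X) (at_index F y) (uf_hom_ftr X (c y))"
    by (rule exE)
  have "ultramatrix_represents X Y (\<lambda>x y. fst (c y) x) (\<lambda>y. snd (c y)) F"
    unfolding ultramatrix_represents_def ultramatrix_def
    using one c by (auto simp: Obj_uf_cat Obj_fam_cat ultras_def)
  then show ?thesis by (intro exI)
qed

text \<open>A representing object must have its elements in \<open>'u\<close>, while the entries of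
  a composite matrix lie in a product type. Embedding the entries and transporting the ultrafilter
  leaves the reduced power unchanged.\<close>

lemma ultramatrix_imp_pointwise_representable:
  fixes K :: "('x, 'z, 'u) uesp" and L :: "'x \<Rightarrow> 'z \<Rightarrow> 'l set"
  assumes K: "ultramatrix_represents X Z L \<W> K"
  shows "pointwise_representable X Z K"
  unfolding pointwise_representable_def
proof (intro conjI ballI)
  show one: "one_cell X Z K" using K by (simp add: ultramatrix_represents_def)
  fix z assume z: "z \<in> Z"
  have sL: "\<And>x. x \<in> X \<Longrightarrow> small TYPE('u) (L x z)"
    and W: "ultrafilter_on (SIGMA x:X. L x z) (\<W> z)"
    using K z by (simp_all add: ultramatrix_represents_def ultramatrix_def)
  have "\<forall>x\<in>X. \<exists>i :: 'l \<Rightarrow> 'u. inj_on i (L x z)"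
    by (intro ballI small_imp_embedding sL)
  from bchoice[OF this] obtain i :: "'x \<Rightarrow> 'l \<Rightarrow> 'u" where i: "\<forall>x\<in>X. inj_on (i x) (L x z)"
    by (rule exE)
  \<comment> \<open>Empty off \<open>X\<close>, as objects of \<open>fam_cat X\<close> have to
    be.\<close>
  define A where "A x = (if x \<in> X then i x ` L x z else {})" for x
  define j where "j p = (fst p, i (fst p) (snd p))" for p
  have lW: "large (\<W> z) (SIGMA x:X. L x z)" by (rule ultrafilter_on_large[OF W])
  have U: "ultrafilter_on (Sigma X A) (filtermap j (\<W> z))"
  proof (rule ultrafilter_on_filtermap[OF W])
    show "\<forall>\<^sub>F p in \<W> z. j p \<in> Sigma X A"
      using lW by eventually_elim (auto simp: j_def A_def)
  qed
  have "reduced_power X (filtermap j (\<W> z)) (at_index (integral X K) z)"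
  proof (rule reduced_power_filtermap[OF reduced_power_if_represented[OF K z] lW])
    show "inj_on j (SIGMA x:X. L x z)"
      using i by (auto simp: inj_on_def j_def)
    show "fst (j p) = fst p" for p by (simp add: j_def)
  qed
  then have "set_iso (uf_cat X) (at_index K z) (uf_hom_ftr X (A, filtermap j (\<W> z)))"
    by (rule represented_if_reduced_power[OF one U])
  moreover have "(A, filtermap j (\<W> z)) \<in> Obj (uf_cat X)"
    using U by (auto simp: Obj_uf_cat Obj_fam_cat ultras_def A_def intro: small_image sL)
  ultimately show "\<exists>c :: ('x, 'u) ufobj. c \<in> Obj (uf_cat X) \<and>
      set_iso (uf_cat X) (at_index K z) (uf_hom_ftr X c)" by blast
qed

text \<open>The candidate \<open>K\<close> consists of the hom-functors of the composite
  ultramatrix, encoded in \<open>'u\<close>. For every \<open>z\<close>, the component of its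
  integral and that of the composite functor are reduced powers modulo the same ultrafilter, hence
  isomorphic.\<close>

lemma composite_exists:
  fixes F :: "('x, 'y, 'u) uesp" and G :: "('y, 'z, 'u) uesp"
  assumes u: "set_universe TYPE('u)" and X: "small TYPE('u) X" and Y: "small TYPE('u) Y"
    and F: "ultramatrix_represents X Y M \<U> F" and G: "ultramatrix_represents Y Z N \<V> G"
  shows "\<exists>K. is_composite X Y Z G F K"
proof -
  let ?C = "fam_cat X :: ('x \<Rightarrow> 'u set, 'x \<Rightarrow> 'u \<Rightarrow> 'u) category"
  let ?D = "uf_cat X :: (('x, 'u) ufobj, ('x, 'u, 'u) pmap set) category"
  have oneF: "is_functor ?D (fam_cat Y) F"
    using F by (simp add: ultramatrix_represents_def one_cell_def)
  \<comment> \<open>Encodes the integral of \<open>F\<close> with values in \<open>'u\<close>, so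
    that it can be followed by the integral of \<open>G\<close>; this requires the set of
    ultrafilters on each family to be small.\<close>
  have "\<exists>T :: ('x \<Rightarrow> 'u set, 'x \<Rightarrow> 'u \<Rightarrow> 'u, 'y \<Rightarrow> 'u set, 'y \<Rightarrow> 'u \<Rightarrow> 'u) ftr.
    is_functor ?C (fam_cat Y) T \<and> (\<forall>y\<in>Y. set_iso ?C (at_index T y) (uf_integral X (at_index F y)))"
  proof (rule small_set_functors_imp_fam_functor)
    fix y assume "y \<in> Y"
    show "set_functor ?C (uf_integral X (at_index F y))"
      by (rule set_functor_uf_integral[OF set_functor_at_index[OF oneF]])
  next
    fix y and H :: "'x \<Rightarrow> 'u set" assume y: "y \<in> Y" and H: "H \<in> Obj ?C"
    show "small TYPE('u) (fobj (uf_integral X (at_index F y)) H)"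
      unfolding fobj_uf_integral
    proof (rule small_Sigma[OF u])
      show "small TYPE('u) (ultras X H)"
        using H by (intro small_ultras[OF u X]) (simp add: Obj_fam_cat)
      fix \<W> assume "\<W> \<in> ultras X H"
      then show "small TYPE('u) (fobj (at_index F y) (H, \<W>))"
        using is_functor_fobj[OF oneF uf_catI[OF H]] y by (simp add: at_index_def Obj_fam_cat)
    qed
  qed
  then obtain T :: "('x \<Rightarrow> 'u set, 'x \<Rightarrow> 'u \<Rightarrow> 'u, 'y \<Rightarrow> 'u set, 'y \<Rightarrow> 'u \<Rightarrow> 'u) ftr"
    where T: "is_functor ?C (fam_cat Y) T" and
      "\<forall>y\<in>Y. set_iso ?C (at_index T y) (uf_integral X (at_index F y))"
    by blast
  then have TF: "fam_iso ?C Y T (integral X F)"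
    by (simp add: fam_iso_def at_index_integral)
  let ?e = "\<lambda>z. (\<lambda>x. mat_comp Y N M x z, mat_ultra_comp \<V> \<U> z)"
  have NM: "ultramatrix TYPE('u) X Z (mat_comp Y N M) (mat_ultra_comp \<V> \<U>)"
    using F G by (intro ultramatrix_comp[OF u Y]) (simp_all add: ultramatrix_represents_def)
  have "\<exists>K :: ('x, 'z, 'u) uesp.
    is_functor ?D (fam_cat Z) K \<and> (\<forall>z\<in>Z. set_iso ?D (at_index K z) (uf_hom_ftr X (?e z)))"
  proof (rule small_set_functors_imp_fam_functor)
    fix z assume z: "z \<in> Z"
    show "set_functor ?D (uf_hom_ftr X (?e z))" by (rule set_functor_uf_hom_ftr)
    fix d assume "d \<in> Obj ?D"
    then have "small TYPE('u) (uf_hom X (?e z) d)"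
      using NM z by (intro small_uf_hom[OF u X]) (simp_all add: ultramatrix_def Obj_uf_cat Obj_fam_cat)
    then show "small TYPE('u) (fobj (uf_hom_ftr X (?e z)) d)" by (simp add: uf_hom_ftr_def)
  qed
  then obtain K :: "('x, 'z, 'u) uesp" where K: "is_functor ?D (fam_cat Z) K"
    and Ke: "\<forall>z\<in>Z. set_iso ?D (at_index K z) (uf_hom_ftr X (?e z))" by blast
  have KNM: "ultramatrix_represents X Z (mat_comp Y N M) (mat_ultra_comp \<V> \<U>) K"
    using NM K Ke by (simp add: ultramatrix_represents_def one_cell_def)
  have KT: "fam_iso ?C Z (integral X K) (ftr_comp (integral Y G) T)"
    unfolding fam_iso_def
  proof (intro ballI)
    fix z assume z: "z \<in> Z"
    show "set_iso ?C (at_index (integral X K) z) (at_index (ftr_comp (integral Y G) T) z)"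
      using reduced_power_if_represented[OF KNM z] reduced_power_integral_comp[OF F G T TF z]
      by (rule reduced_power_unique)
  qed
  have "is_composite X Y Z G F K"
    unfolding is_composite_def one_cell_def using K T TF KT by blast
  then show ?thesis by (rule exI)
qed

theorem proposition31:
  fixes X :: "'x set" and Y :: "'y set" and Z :: "'z set"
    and F :: "('x, 'y, 'u) uesp" and G :: "('y, 'z, 'u) uesp"
  assumes "set_universe TYPE('u)"
    and "small TYPE('u) X" and "small TYPE('u) Y" and "small TYPE('u) Z"
    and "one_cell X Y F" and "one_cell Y Z G"
  shows
    "(pointwise_representable X Y F \<and> pointwise_representable Y Z G \<longrightarrow>
        (\<exists>K. is_composite X Y Z G F K) \<and>
        (\<forall>K. is_composite X Y Z G F K \<longrightarrow> pointwise_representable X Z K))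
     \<and>
     (\<forall>(M :: 'x \<Rightarrow> 'y \<Rightarrow> 'm set) \<U> (N :: 'y \<Rightarrow> 'z \<Rightarrow> 'n set) \<V>.
        ultramatrix_represents X Y M \<U> F \<and> ultramatrix_represents Y Z N \<V> G \<longrightarrow>
        (\<forall>K. is_composite X Y Z G F K \<longrightarrow>
           ultramatrix_represents X Z (mat_comp Y N M) (mat_ultra_comp \<V> \<U>) K))
     \<and>
     (\<forall>(M :: 'a set) f g \<U> (N :: 'b set) h k \<V>.
        ultraspan_represents X Y M f g \<U> F \<and> ultraspan_represents Y Z N h k \<V> G \<longrightarrow>
        (\<forall>K. is_composite X Y Z G F K \<longrightarrow>
           ultraspan_represents X Z (span_apex M N g h) (f \<circ> fst) (k \<circ> snd)
             (span_ultra_comp h \<V> \<U>) K))"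
proof (intro conjI impI allI; elim conjE)
  assume "pointwise_representable X Y F" "pointwise_representable Y Z G"
  then obtain M :: "'x \<Rightarrow> 'y \<Rightarrow> 'u set" and \<U> and N :: "'y \<Rightarrow> 'z \<Rightarrow> 'u set" and \<V>
    where MN: "ultramatrix_represents X Y M \<U> F" "ultramatrix_represents Y Z N \<V> G"
    using pointwise_representable_imp_ultramatrix by metis
  show "\<exists>K. is_composite X Y Z G F K"
    by (rule composite_exists[OF assms(1-3) MN])
  \<comment> \<open>The composite ultramatrix represents \<open>K\<close>, but over the type
    \<open>'y \<times> 'u \<times> 'u\<close>; the rule moves its columns into
    \<open>'u\<close>.\<close>
  show "pointwise_representable X Z K" if "is_composite X Y Z G F K" for K
    by (rule ultramatrix_imp_pointwise_representable[OF
          ultramatrix_represents_composite[OF assms(1,3) MN that]])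
qed (rule ultramatrix_represents_composite[OF assms(1,3)] ultraspan_represents_composite[OF assms(1)];
    assumption)+

end
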